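(* Let $\boldsymbol{a}\in\mathbb{Z}^3\setminus\{\boldsymbol{0}\}$ and let $\theta\in\Theta_3$ with $\theta\neq 0,\pi/2,\pi$. Then $\theta\in\Theta_3(\boldsymbol{a})$ if and only if $$(\|\boldsymbol{a}\|^2,\|\boldsymbol{a}\|^2)_p\,(\|\boldsymbol{a}\|^2,\tan^2\theta)_p\,(\tan^2\theta,\tan^2\theta)_p=1$$ holds for every odd prime $p$.
   Context: For nonzero $\boldsymbol{a},\boldsymbol{b}\in\mathbb{R}^3$, $\angle(\boldsymbol{a},\boldsymbol{b}):=\arccos\dfrac{\boldsymbol{a}\cdot\boldsymbol{b}}{\|\boldsymbol{a}\|\,\|\boldsymbol{b}\|}\in[0,\pi]$, with the standard scalar product and Euclidean norm. $\Theta_3:=\{\angle(\boldsymbol{a},\boldsymbol{b})\mid \boldsymbol{a},\boldsymbol{b}\in\mathbb{Z}^3\setminus\{\boldsymbol{0}\}\}$, and for $\boldsymbol{a}\in\mathbb{Z}^3\setminus\{\boldsymbol{0}\}$, $\Theta_3(\boldsymbol{a}):=\{\angle(\boldsymbol{a},\boldsymbol{b})\mid \boldsymbol{b}\in\mathbb{Z}^3\setminus\{\boldsymbol{0}\}\}$. For $\theta\in\Theta_3\setminus\{0,\pi/2,\pi\}$ the number $\tan^2\theta$ is a positive rational. For a prime $p$ and nonzero rationals $x,y$, $(x,y)_p$ denotes the Hilbert symbol over $\mathbb{Q}_p$: it equals $1$ if $Z^2=xX^2+yY^2$ has a solution $(X,Y,Z)\neq(0,0,0)$ in $\mathbb{Q}_p^3$,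 and $-1$ otherwise. *)

theory Defs
  imports
    "HOL-Analysis.Analysis"
    "HOL-Algebra.QuotRing"
    "HOL-Computational_Algebra.Primes"
begin

section \<open>Angles between integer vectors\<close>

definition vec_angle :: "real ^ 3 \<Rightarrow> real ^ 3 \<Rightarrow> real" where
  "vec_angle a b = arccos ((a \<bullet> b) / (norm a * norm b))"

definition integer_lattice :: "(real ^ 3) set" where
  "integer_lattice = {a. \<forall>i. a $ i \<in> \<int>}"

definition Theta3 :: "real set" where
  "Theta3 = {vec_angle a b | a b. a \<in> integer_lattice - {0} \<and> b \<in> integer_lattice - {0}}"

definition Theta3_at :: "real ^ 3 \<Rightarrow> real set" where
  "Theta3_at a = {vec_angle a b | b. b \<in> integer_lattice - {0}}"

text \<open>
  The rational number equal to a given real; meaningful only on rational reals.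
  Lemmas \<open>of_rat_norm_sq\<close> and \<open>of_rat_tan_sq\<close> below show that it is only applied
  to such.
\<close>

definition rat_of_real :: "real \<Rightarrow> rat" where
  "rat_of_real x = (THE q. of_rat q = x)"


section \<open>The field of p-adic numbers\<close>

text \<open>
  The completion of the rationals at \<open>p\<close>: the ring of Cauchy sequences for the
  p-adic absolute value, modulo the ideal of null sequences.
\<close>

definition padic_val :: "nat \<Rightarrow> rat \<Rightarrow> int" where
  "padic_val p x = (case quotient_of x of (a, b) \<Rightarrow>
     int (multiplicity (int p) a) - int (multiplicity (int p) b))"

definition padic_abs :: "nat \<Rightarrow> rat \<Rightarrow> real" where
  "padic_abs p x = (if x = 0 then 0 else real p powi (- padic_val p x))"

definition padic_Cauchy :: "nat \<Rightarrow> (nat \<Rightarrow> rat) \<Rightarrow> bool" where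
  "padic_Cauchy p X \<longleftrightarrow> (\<forall>e>0. \<exists>N. \<forall>m\<ge>N. \<forall>n\<ge>N. padic_abs p (X m - X n) < e)"

definition padic_Cauchy_ring :: "nat \<Rightarrow> (nat \<Rightarrow> rat) ring" where
  "padic_Cauchy_ring p = \<lparr>carrier = {X. padic_Cauchy p X},
     mult = (\<lambda>X Y n. X n * Y n), one = (\<lambda>n. 1),
     zero = (\<lambda>n. 0), add = (\<lambda>X Y n. X n + Y n)\<rparr>"

definition padic_null :: "nat \<Rightarrow> (nat \<Rightarrow> rat) set" where
  "padic_null p = {X. (\<lambda>n. padic_abs p (X n)) \<longlonglongrightarrow> 0}"

definition padic_field :: "nat \<Rightarrow> (nat \<Rightarrow> rat) set ring" where
  "padic_field p = padic_Cauchy_ring p Quot padic_null p"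

definition padic_of_rat :: "nat \<Rightarrow> rat \<Rightarrow> (nat \<Rightarrow> rat) set" where
  "padic_of_rat p x = padic_null p +>\<^bsub>padic_Cauchy_ring p\<^esub> (\<lambda>n. x)"

definition hilbert_symbol :: "nat \<Rightarrow> rat \<Rightarrow> rat \<Rightarrow> int" where
  "hilbert_symbol p x y =
     (if \<exists>X \<in> carrier (padic_field p). \<exists>Y \<in> carrier (padic_field p). \<exists>Z \<in> carrier (padic_field p).
           (X, Y, Z) \<noteq> (\<zero>\<^bsub>padic_field p\<^esub>, \<zero>\<^bsub>padic_field p\<^esub>, \<zero>\<^bsub>padic_field p\<^esub>) \<and>
           Z [^]\<^bsub>padic_field p\<^esub> (2::nat) =
             padic_of_rat p x \<otimes>\<^bsub>padic_field p\<^esub> X [^]\<^bsub>padic_field p\<^esub> (2::nat) \<oplus>\<^bsub>padic_field p\<^esub>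
             padic_of_rat p y \<otimes>\<^bsub>padic_field p\<^esub> Y [^]\<^bsub>padic_field p\<^esub> (2::nat)
      then 1 else -1)"


section \<open>Well-definedness\<close>

lemma of_rat_rat_of_real: "x \<in> \<rat> \<Longrightarrow> of_rat (rat_of_real x) = x"
  unfolding rat_of_real_def by (rule theI') (auto elim!: Rats_cases)

lemma integer_lattice_inner: "a \<in> integer_lattice \<Longrightarrow> b \<in> integer_lattice \<Longrightarrow> a \<bullet> b \<in> \<int>"
  by (auto simp: integer_lattice_def inner_vec_def intro!: Ints_sum Ints_mult)

lemma of_rat_norm_sq:
  assumes "a \<in> integer_lattice"
  shows "of_rat (rat_of_real ((norm a)\<^sup>2)) = (norm a)\<^sup>2"
  using integer_lattice_inner[OF assms assms] Ints_subset_Rats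
  by (intro of_rat_rat_of_real) (auto simp: dot_square_norm)

lemma tan_sq_vec_angle:
  assumes "a \<noteq> 0" "b \<noteq> 0" "vec_angle a b \<noteq> pi / 2"
  shows "(tan (vec_angle a b))\<^sup>2 = (a \<bullet> a) * (b \<bullet> b) / (a \<bullet> b)\<^sup>2 - 1"
proof -
  have "\<bar>(a \<bullet> b) / (norm a * norm b)\<bar> \<le> 1"
    using Cauchy_Schwarz_ineq2[of a b] assms by (simp add: abs_mult field_simps)
  then have c: "cos (vec_angle a b) = (a \<bullet> b) / (norm a * norm b)"
    unfolding vec_angle_def by (intro cos_arccos_abs)
  have ne: "a \<bullet> b \<noteq> 0"
    using assms(3) by (auto simp: vec_angle_def)
  have "(tan (vec_angle a b))\<^sup>2 = 1 / (cos (vec_angle a b))\<^sup>2 - 1"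
    using ne assms tan_sec[of "vec_angle a b"] by (simp add: c power_divide)
  then show ?thesis
    using ne assms by (simp add: c power_divide power_mult_distrib power2_norm_eq_inner)
qed

lemma of_rat_tan_sq:
  assumes "\<theta> \<in> Theta3" "\<theta> \<noteq> pi / 2"
  shows "of_rat (rat_of_real ((tan \<theta>)\<^sup>2)) = (tan \<theta>)\<^sup>2"
proof (rule of_rat_rat_of_real)
  obtain a b where ab: "a \<in> integer_lattice - {0}" "b \<in> integer_lattice - {0}" "\<theta> = vec_angle a b"
    using assms(1) by (auto simp: Theta3_def)
  then have "a \<bullet> a \<in> \<rat>" "b \<bullet> b \<in> \<rat>" "a \<bullet> b \<in> \<rat>"
    using integer_lattice_inner Ints_subset_Rats by blast+
  then show "(tan \<theta>)\<^sup>2 \<in> \<rat>"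
    using tan_sq_vec_angle[of a b] ab assms(2) by auto
qed

lemma padic_val_divide:
  assumes "prime p" "a \<noteq> 0" "b \<noteq> 0"
  shows "padic_val p (of_int a / of_int b) =
    int (multiplicity (int p) a) - int (multiplicity (int p) b)"
proof -
  obtain c d where cd: "quotient_of (of_int a / of_int b) = (c, d)"
    by fastforce
  have d: "d > 0"
    using quotient_of_denom_pos[OF cd] .
  have eq: "(of_int a / of_int b :: rat) = of_int c / of_int d"
    using quotient_of_div[OF cd] .
  then have "(of_int (a * d) :: rat) = of_int (c * b)"
    using assms d by (simp add: field_simps)
  then have ad: "a * d = c * b"
    by (simp only: of_int_eq_iff)
  moreover have "c \<noteq> 0"
    using ad assms d by auto
  moreover have "prime_elem (int p)"
    using assms by simp
  ultimately have "multiplicity (int p) a + multiplicity (int p) d =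
      multiplicity (int p) c + multiplicity (int p) b"
    using assms d by (metis less_irrefl prime_elem_multiplicity_mult_distrib)
  then show ?thesis
    by (simp add: padic_val_def cd)
qed

lemma rat_common_denom:
  fixes x y :: rat
  obtains a b c :: int where "x = of_int a / of_int c" "y = of_int b / of_int c" "c \<noteq> 0"
proof -
  obtain a b where 1: "quotient_of x = (a, b)" by fastforce
  obtain c d where 2: "quotient_of y = (c, d)" by fastforce
  have "b > 0" "d > 0" "x = of_int a / of_int b" "y = of_int c / of_int d"
    using 1 2 quotient_of_denom_pos quotient_of_div by blast+
  then show ?thesis
    by (intro that[of "a * d" "b * d" "c * b"]) auto
qed

lemma padic_abs_0 [simp]: "padic_abs p 0 = 0"
  and padic_abs_1 [simp]: "padic_abs p 1 = 1"
  by (auto simp: padic_abs_def padic_val_def)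

lemma padic_abs_nonneg [simp]: "padic_abs p x \<ge> 0"
  by (simp add: padic_abs_def)

lemma padic_abs_pos: "prime p \<Longrightarrow> x \<noteq> 0 \<Longrightarrow> padic_abs p x > 0"
  by (auto simp: padic_abs_def prime_gt_0_nat)

lemma padic_val_mult:
  assumes "prime p" "x \<noteq> 0" "y \<noteq> 0"
  shows "padic_val p (x * y) = padic_val p x + padic_val p y"
proof -
  obtain a b c where abc: "x = of_int a / of_int c" "y = of_int b / of_int c" "c \<noteq> 0"
    by (rule rat_common_denom)
  have xy: "x * y = of_int (a * b) / of_int (c * c)"
    using abc by simp
  have "a \<noteq> 0" "b \<noteq> 0" "prime_elem (int p)"
    using abc assms by auto
  moreover have "padic_val p (x * y) = int (multiplicity (int p) (a * b)) - int (multiplicity (int p) (c * c))"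
    unfolding xy using calculation abc(3) assms(1) by (intro padic_val_divide) auto
  ultimately show ?thesis
    using abc(3) padic_val_divide[OF assms(1), of a c] padic_val_divide[OF assms(1), of b c] assms(1)
    by (simp add: abc(1,2) prime_elem_multiplicity_mult_distrib)
qed

lemma padic_abs_mult:
  assumes "prime p"
  shows "padic_abs p (x * y) = padic_abs p x * padic_abs p y"
  using assms prime_gt_0_nat[OF assms]
  by (auto simp: padic_abs_def padic_val_mult power_int_add[symmetric] simp flip: power_int_add)

lemma padic_abs_minus [simp]:
  assumes "prime p"
  shows "padic_abs p (- x) = padic_abs p x"
proof -
  have "padic_abs p (- 1) * padic_abs p (- 1) = 1"
    using padic_abs_mult[OF assms, of "- 1" "- 1"] by simp
  then have "padic_abs p (- 1) = 1"
    by (metis abs_1 abs_mult_self_eq padic_abs_nonneg abs_of_nonneg power2_eq_square power2_eq_1_iff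
        abs_minus_cancel)
  then show ?thesis
    using padic_abs_mult[OF assms, of "- 1" x] by simp
qed

lemma padic_abs_diff_commute:
  "prime p \<Longrightarrow> padic_abs p (x - y) = padic_abs p (y - x)"
  by (metis minus_diff_eq padic_abs_minus)

lemma padic_abs_add:
  assumes "prime p"
  shows "padic_abs p (x + y) \<le> max (padic_abs p x) (padic_abs p y)"
proof (cases "x = 0 \<or> y = 0 \<or> x + y = 0")
  case True
  then show ?thesis
    by (auto simp: max_def)
next
  case False
  obtain a b c where abc: "x = of_int a / of_int c" "y = of_int b / of_int c" "c \<noteq> 0"
    by (rule rat_common_denom)
  have xy: "x + y = of_int (a + b) / of_int c"
    using abc by (simp add: add_divide_distrib)
  have ne: "a \<noteq> 0" "b \<noteq> 0" "a + b \<noteq> 0"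
    using False abc xy by auto
  define k where "k = min (multiplicity (int p) a) (multiplicity (int p) b)"
  have "int p ^ k dvd a + b"
    by (intro dvd_add multiplicity_dvd') (auto simp: k_def)
  then have "k \<le> multiplicity (int p) (a + b)"
    using ne assms by (intro multiplicity_geI) (auto simp: prime_ge_2_nat not_prime_unit dest: prime_nat_not_dvd)
  then have "min (padic_val p x) (padic_val p y) \<le> padic_val p (x + y)"
    using padic_val_divide[OF assms ne(1) abc(3)] padic_val_divide[OF assms ne(2) abc(3)]
      padic_val_divide[OF assms ne(3) abc(3), folded xy]
    by (simp add: abc(1,2)[symmetric] k_def min_def split: if_splits)
  then have "- padic_val p (x + y) \<le> - padic_val p x \<or> - padic_val p (x + y) \<le> - padic_val p y"
    by linarith
  moreover have "1 \<le> real p"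
    using prime_ge_1_nat[OF assms] by simp
  ultimately show ?thesis
    using False by (auto simp: padic_abs_def le_max_iff_disj intro: power_int_increasing)
qed

lemma padic_abs_add_le:
  "prime p \<Longrightarrow> padic_abs p (x + y) \<le> padic_abs p x + padic_abs p y"
  by (smt (verit) padic_abs_add padic_abs_nonneg)

lemma padic_Cauchy_bounded:
  assumes "prime p" "padic_Cauchy p X"
  obtains B where "B > 0" "\<And>n. padic_abs p (X n) \<le> B"
proof -
  obtain N where N: "\<And>m n. m \<ge> N \<Longrightarrow> n \<ge> N \<Longrightarrow> padic_abs p (X m - X n) < 1"
    using assms(2) unfolding padic_Cauchy_def by (meson zero_less_one)
  define B where "B = 1 + (\<Sum>n\<le>N. padic_abs p (X n))"
  have S: "padic_abs p (X n) \<le> (\<Sum>n\<le>N. padic_abs p (X n))" if "n \<le> N" for n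
    using that by (intro member_le_sum) auto
  have "padic_abs p (X n) \<le> B" for n
  proof (cases "n \<le> N")
    case True
    then show ?thesis using S[of n] by (simp add: B_def)
  next
    case False
    then have "padic_abs p (X n) \<le> padic_abs p (X n - X N) + padic_abs p (X N)"
      using padic_abs_add_le[OF assms(1), of "X n - X N" "X N"] by simp
    also have "\<dots> \<le> B"
      using N[of n N] S[of N] False by (simp add: B_def)
    finally show ?thesis .
  qed
  moreover have "B > 0"
    unfolding B_def by (smt (verit) padic_abs_nonneg sum_nonneg)
  ultimately show ?thesis using that by blast
qed

lemma padic_Cauchy_const [simp]: "padic_Cauchy p (\<lambda>n. x)"
  by (simp add: padic_Cauchy_def)

lemma padic_Cauchy_add:
  assumes "prime p" "padic_Cauchy p X" "padic_Cauchy p Y"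
  shows "padic_Cauchy p (\<lambda>n. X n + Y n)"
  unfolding padic_Cauchy_def
proof (intro allI impI)
  fix e :: real assume "e > 0"
  then obtain M N where
    M: "\<And>m n. m \<ge> M \<Longrightarrow> n \<ge> M \<Longrightarrow> padic_abs p (X m - X n) < e" and
    N: "\<And>m n. m \<ge> N \<Longrightarrow> n \<ge> N \<Longrightarrow> padic_abs p (Y m - Y n) < e"
    using assms(2,3) unfolding padic_Cauchy_def by meson
  have "padic_abs p (X m + Y m - (X n + Y n)) < e" if "m \<ge> max M N" "n \<ge> max M N" for m n
    using padic_abs_add[OF assms(1), of "X m - X n" "Y m - Y n"] M[of m n] N[of m n] that
    by (simp add: algebra_simps)
  then show "\<exists>N. \<forall>m\<ge>N. \<forall>n\<ge>N. padic_abs p (X m + Y m - (X n + Y n)) < e"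
    by blast
qed

lemma padic_Cauchy_mult:
  assumes "prime p" "padic_Cauchy p X" "padic_Cauchy p Y"
  shows "padic_Cauchy p (\<lambda>n. X n * Y n)"
  unfolding padic_Cauchy_def
proof (intro allI impI)
  fix e :: real assume e: "e > 0"
  obtain B where B: "B > 0" "\<And>n. padic_abs p (X n) \<le> B"
    using padic_Cauchy_bounded[OF assms(1,2)] by blast
  obtain C where C: "C > 0" "\<And>n. padic_abs p (Y n) \<le> C"
    using padic_Cauchy_bounded[OF assms(1,3)] by blast
  have "e / C > 0" "e / B > 0"
    using e B C by auto
  then obtain M N where
    M: "\<And>m n. m \<ge> M \<Longrightarrow> n \<ge> M \<Longrightarrow> padic_abs p (X m - X n) < e / C" and
    N: "\<And>m n. m \<ge> N \<Longrightarrow> n \<ge> N \<Longrightarrow> padic_abs p (Y m - Y n) < e / B"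
    using assms(2,3) unfolding padic_Cauchy_def by meson
  have "padic_abs p (X m * Y m - X n * Y n) < e" if mn: "m \<ge> max M N" "n \<ge> max M N" for m n
  proof -
    have "padic_abs p (X m * (Y m - Y n)) \<le> B * padic_abs p (Y m - Y n)"
      using B by (simp add: padic_abs_mult[OF assms(1)] mult_right_mono)
    also have "\<dots> < e"
      using N[of m n] mn B by (simp add: field_simps)
    finally have 1: "padic_abs p (X m * (Y m - Y n)) < e" .
    have "padic_abs p ((X m - X n) * Y n) \<le> padic_abs p (X m - X n) * C"
      using C by (simp add: padic_abs_mult[OF assms(1)] mult_left_mono)
    also have "\<dots> < e"
      using M[of m n] mn C by (simp add: field_simps)
    finally have 2: "padic_abs p ((X m - X n) * Y n) < e" .
    have "X m * Y m - X n * Y n = X m * (Y m - Y n) + (X m - X n) * Y n"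
      by (simp add: algebra_simps)
    then show ?thesis
      using padic_abs_add[OF assms(1), of "X m * (Y m - Y n)" "(X m - X n) * Y n"] 1 2 by simp
  qed
  then show "\<exists>N. \<forall>m\<ge>N. \<forall>n\<ge>N. padic_abs p (X m * Y m - X n * Y n) < e"
    by blast
qed

lemma padic_Cauchy_uminus:
  assumes "prime p" "padic_Cauchy p X"
  shows "padic_Cauchy p (\<lambda>n. - X n)"
  using padic_Cauchy_mult[OF assms(1) padic_Cauchy_const[of p "- 1"] assms(2)] by simp

lemma padic_Cauchy_ring_cring:
  assumes "prime p"
  shows "cring (padic_Cauchy_ring p)"
proof (rule cringI)
  show "abelian_group (padic_Cauchy_ring p)"
  proof (rule abelian_groupI)
    fix X assume "X \<in> carrier (padic_Cauchy_ring p)"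
    then show "\<exists>Y\<in>carrier (padic_Cauchy_ring p).
        Y \<oplus>\<^bsub>padic_Cauchy_ring p\<^esub> X = \<zero>\<^bsub>padic_Cauchy_ring p\<^esub>"
      by (intro bexI[of _ "\<lambda>n. - X n"])
         (auto simp: padic_Cauchy_ring_def padic_Cauchy_uminus assms)
  qed (auto simp: padic_Cauchy_ring_def padic_Cauchy_add assms algebra_simps)
  show "comm_monoid (padic_Cauchy_ring p)"
    by (rule comm_monoidI)
       (auto simp: padic_Cauchy_ring_def padic_Cauchy_mult assms algebra_simps)
qed (auto simp: padic_Cauchy_ring_def algebra_simps)

lemma padic_null_iff:
  "X \<in> padic_null p \<longleftrightarrow> (\<forall>e>0. \<exists>N. \<forall>n\<ge>N. padic_abs p (X n) < e)"
  by (simp add: padic_null_def LIMSEQ_iff)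

lemma padic_null_Cauchy:
  assumes "prime p" "X \<in> padic_null p"
  shows "padic_Cauchy p X"
  unfolding padic_Cauchy_def
proof (intro allI impI)
  fix e :: real assume "e > 0"
  then obtain N where N: "\<And>n. n \<ge> N \<Longrightarrow> padic_abs p (X n) < e"
    using assms(2) unfolding padic_null_iff by blast
  have "padic_abs p (X m - X n) < e" if "m \<ge> N" "n \<ge> N" for m n
    using padic_abs_add[OF assms(1), of "X m" "- X n"] N[of m] N[of n] that assms(1) by simp
  then show "\<exists>N. \<forall>m\<ge>N. \<forall>n\<ge>N. padic_abs p (X m - X n) < e"
    by blast
qed

lemma padic_null_add:
  assumes "prime p" "X \<in> padic_null p" "Y \<in> padic_null p"
  shows "(\<lambda>n. X n + Y n) \<in> padic_null p"
proof -
  have "(\<lambda>n. padic_abs p (X n) + padic_abs p (Y n)) \<longlonglongrightarrow> 0"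
    using tendsto_add[of _ 0 _ _ 0] assms(2,3) by (fastforce simp: padic_null_def)
  then show ?thesis
    unfolding padic_null_def mem_Collect_eq
    by (rule tendsto_sandwich[OF _ _ tendsto_const, rotated 2])
       (auto simp: padic_abs_add_le assms(1))
qed

lemma padic_null_mult:
  assumes "prime p" "X \<in> padic_null p" "padic_Cauchy p Y"
  shows "(\<lambda>n. X n * Y n) \<in> padic_null p"
proof -
  obtain B where B: "B > 0" "\<And>n. padic_abs p (Y n) \<le> B"
    using padic_Cauchy_bounded[OF assms(1,3)] by blast
  have "(\<lambda>n. padic_abs p (X n) * B) \<longlonglongrightarrow> 0"
    using tendsto_mult_right[of "\<lambda>n. padic_abs p (X n)" 0 _ B] assms(2)
    by (simp add: padic_null_def)
  then show ?thesis
    unfolding padic_null_def mem_Collect_eq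
    by (rule tendsto_sandwich[OF _ _ tendsto_const, rotated 2])
       (auto simp: padic_abs_mult assms(1) B mult_left_mono)
qed

lemma padic_null_uminus:
  assumes "prime p" "X \<in> padic_null p"
  shows "(\<lambda>n. - X n) \<in> padic_null p"
  using assms by (simp add: padic_null_def)

lemma padic_null_ideal:
  assumes "prime p"
  shows "ideal (padic_null p) (padic_Cauchy_ring p)"
proof -
  interpret cring "padic_Cauchy_ring p"
    by (rule padic_Cauchy_ring_cring[OF assms])
  have inv: "\<ominus>\<^bsub>padic_Cauchy_ring p\<^esub> X = (\<lambda>n. - X n)" if "padic_Cauchy p X" for X
  proof (rule minus_equality)
    show "(\<lambda>n. - X n) \<oplus>\<^bsub>padic_Cauchy_ring p\<^esub> X = \<zero>\<^bsub>padic_Cauchy_ring p\<^esub>"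
      by (simp add: padic_Cauchy_ring_def)
  qed (use that in \<open>auto simp: padic_Cauchy_ring_def padic_Cauchy_uminus assms\<close>)
  show ?thesis
  proof (rule idealI)
    show "ring (padic_Cauchy_ring p)" ..
    show "subgroup (padic_null p) (add_monoid (padic_Cauchy_ring p))"
    proof (rule add.subgroupI)
      show "padic_null p \<subseteq> carrier (padic_Cauchy_ring p)"
        using padic_null_Cauchy[OF assms] by (auto simp: padic_Cauchy_ring_def)
      have "(\<lambda>n. 0) \<in> padic_null p"
        by (simp add: padic_null_def)
      then show "padic_null p \<noteq> {}" by blast
      show "\<ominus>\<^bsub>padic_Cauchy_ring p\<^esub> X \<in> padic_null p" if "X \<in> padic_null p" for X
        using that by (simp add: inv padic_null_Cauchy padic_null_uminus assms)
      show "X \<oplus>\<^bsub>padic_Cauchy_ring p\<^esub> Y \<in> padic_null p"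
        if "X \<in> padic_null p" "Y \<in> padic_null p" for X Y
        using that by (simp add: padic_Cauchy_ring_def padic_null_add assms)
    qed
    fix X Y assume XY: "X \<in> padic_null p" "Y \<in> carrier (padic_Cauchy_ring p)"
    then show "X \<otimes>\<^bsub>padic_Cauchy_ring p\<^esub> Y \<in> padic_null p"
      by (simp add: padic_Cauchy_ring_def padic_null_mult assms)
    then show "Y \<otimes>\<^bsub>padic_Cauchy_ring p\<^esub> X \<in> padic_null p"
      by (simp add: padic_Cauchy_ring_def mult.commute)
  qed
qed

lemma padic_Cauchy_away_from_0:
  assumes "prime p" "padic_Cauchy p X" "X \<notin> padic_null p"
  obtains c N where "c > 0" "\<And>n. n \<ge> N \<Longrightarrow> padic_abs p (X n) \<ge> c"
proof -
  obtain e where e: "e > 0" "\<And>N. \<exists>n\<ge>N. padic_abs p (X n) \<ge> e"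
    using assms(3) unfolding padic_null_iff by (meson not_le)
  obtain N where N: "\<And>m n. m \<ge> N \<Longrightarrow> n \<ge> N \<Longrightarrow> padic_abs p (X m - X n) < e"
    using assms(2) e(1) unfolding padic_Cauchy_def by meson
  obtain m where m: "m \<ge> N" "padic_abs p (X m) \<ge> e"
    using e(2) by blast
  have "padic_abs p (X n) \<ge> e" if "n \<ge> N" for n
    using padic_abs_add[OF assms(1), of "X m - X n" "X n"] N[of m n] m that by simp
  then show ?thesis
    using that e(1) by blast
qed

lemma padic_Cauchy_inverse:
  assumes "prime p" "padic_Cauchy p X" "X \<notin> padic_null p"
  shows "padic_Cauchy p (\<lambda>n. inverse (X n))"
  unfolding padic_Cauchy_def
proof (intro allI impI)
  fix e :: real assume e: "e > 0"
  obtain c M where c: "c > 0" and M: "\<And>n. n \<ge> M \<Longrightarrow> padic_abs p (X n) \<ge> c"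
    using padic_Cauchy_away_from_0[OF assms] by blast
  have "e * c\<^sup>2 > 0"
    using e c by simp
  then obtain N where N: "\<And>m n. m \<ge> N \<Longrightarrow> n \<ge> N \<Longrightarrow> padic_abs p (X m - X n) < e * c\<^sup>2"
    using assms(2) unfolding padic_Cauchy_def by meson
  have "padic_abs p (inverse (X m) - inverse (X n)) < e" if mn: "m \<ge> max M N" "n \<ge> max M N" for m n
  proof -
    let ?d = "inverse (X m) - inverse (X n)"
    have ne: "X m \<noteq> 0" "X n \<noteq> 0"
      using M[of m] M[of n] mn c by auto
    have "?d * (X m * X n) = X n - X m"
      using ne by (simp add: field_simps)
    then have "padic_abs p ?d * (padic_abs p (X m) * padic_abs p (X n)) = padic_abs p (X n - X m)"
      by (metis padic_abs_mult[OF assms(1)])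
    moreover have "c * c \<le> padic_abs p (X m) * padic_abs p (X n)"
      using M[of m] M[of n] mn c by (intro mult_mono) auto
    ultimately have "padic_abs p ?d * (c * c) \<le> padic_abs p (X n - X m)"
      by (metis mult_left_mono padic_abs_nonneg)
    also have "\<dots> < e * (c * c)"
      using N[of n m] mn by (simp add: power2_eq_square)
    finally show ?thesis
      using c by simp
  qed
  then show "\<exists>N. \<forall>m\<ge>N. \<forall>n\<ge>N. padic_abs p (inverse (X m) - inverse (X n)) < e"
    by blast
qed

lemma padic_null_maximalideal:
  assumes "prime p"
  shows "maximalideal (padic_null p) (padic_Cauchy_ring p)"
proof (rule maximalidealI[OF padic_null_ideal[OF assms]])
  interpret cring "padic_Cauchy_ring p"
    by (rule padic_Cauchy_ring_cring[OF assms])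
  have "(\<lambda>n. 1) \<notin> padic_null p"
    by (simp add: padic_null_def LIMSEQ_const_iff)
  then show "carrier (padic_Cauchy_ring p) \<noteq> padic_null p"
    by (auto simp: padic_Cauchy_ring_def)
  fix J assume J: "ideal J (padic_Cauchy_ring p)" "padic_null p \<subseteq> J"
    "J \<subseteq> carrier (padic_Cauchy_ring p)"
  interpret J: ideal J "padic_Cauchy_ring p" by fact
  show "J = padic_null p \<or> J = carrier (padic_Cauchy_ring p)"
  proof (cases "J \<subseteq> padic_null p")
    case False
    then obtain X where X: "X \<in> J" "X \<notin> padic_null p" by blast
    then have XC: "padic_Cauchy p X"
      using J(3) by (auto simp: padic_Cauchy_ring_def)
    let ?Y = "\<lambda>n. inverse (X n)"
    have 1: "(\<lambda>n. X n * ?Y n) \<in> J"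
      using J.I_r_closed[OF X(1), of ?Y] padic_Cauchy_inverse[OF assms XC X(2)]
      by (simp add: padic_Cauchy_ring_def)
    obtain c N where c: "c > 0" "\<And>n. n \<ge> N \<Longrightarrow> padic_abs p (X n) \<ge> c"
      using padic_Cauchy_away_from_0[OF assms XC X(2)] by blast
    have "X n \<noteq> 0" if "n \<ge> N" for n
      using c(1) c(2)[OF that] by auto
    then have "padic_abs p (1 - X n * ?Y n) = 0" if "n \<ge> N" for n
      using that by simp
    then have "(\<lambda>n. 1 - X n * ?Y n) \<in> padic_null p"
      unfolding padic_null_iff by metis
    then have 2: "(\<lambda>n. 1 - X n * ?Y n) \<in> J"
      using J(2) by blast
    have "\<one>\<^bsub>padic_Cauchy_ring p\<^esub> \<in> J"
      using J.a_closed[OF 2 1] by (simp add: padic_Cauchy_ring_def)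
    then show ?thesis
      using J.one_imp_carrier by blast
  qed (use J(2) in blast)
qed

lemma padic_field_is_field:
  assumes "prime p"
  shows "field (padic_field p)"
  unfolding padic_field_def
  using maximalideal.quotient_is_field[OF padic_null_maximalideal[OF assms]
    padic_Cauchy_ring_cring[OF assms]] .

lemma padic_of_rat_closed:
  assumes "prime p"
  shows "padic_of_rat p x \<in> carrier (padic_field p)"
  using ring_hom_closed[OF ideal.rcos_ring_hom[OF padic_null_ideal[OF assms]], of "\<lambda>n. x"]
  by (simp add: padic_of_rat_def padic_field_def padic_Cauchy_ring_def)

lemma padic_of_rat_add:
  assumes "prime p"
  shows "padic_of_rat p (x + y) = padic_of_rat p x \<oplus>\<^bsub>padic_field p\<^esub> padic_of_rat p y"
  using ring_hom_add[OF ideal.rcos_ring_hom[OF padic_null_ideal[OF assms]], of "\<lambda>n. x" "\<lambda>n. y"]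
  by (simp add: padic_of_rat_def padic_field_def padic_Cauchy_ring_def)

lemma padic_of_rat_mult:
  assumes "prime p"
  shows "padic_of_rat p (x * y) = padic_of_rat p x \<otimes>\<^bsub>padic_field p\<^esub> padic_of_rat p y"
  using ring_hom_mult[OF ideal.rcos_ring_hom[OF padic_null_ideal[OF assms]], of "\<lambda>n. x" "\<lambda>n. y"]
  by (simp add: padic_of_rat_def padic_field_def padic_Cauchy_ring_def)

lemma padic_of_rat_1:
  assumes "prime p"
  shows "padic_of_rat p 1 = \<one>\<^bsub>padic_field p\<^esub>"
  using ring_hom_one[OF ideal.rcos_ring_hom[OF padic_null_ideal[OF assms]]]
  by (simp add: padic_of_rat_def padic_field_def padic_Cauchy_ring_def)

lemma padic_of_rat_eq_0_iff:
  assumes "prime p"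
  shows "padic_of_rat p x = \<zero>\<^bsub>padic_field p\<^esub> \<longleftrightarrow> x = 0"
proof -
  interpret ideal "padic_null p" "padic_Cauchy_ring p"
    by (rule padic_null_ideal[OF assms])
  have c: "(\<lambda>n. x) \<in> carrier (padic_Cauchy_ring p)"
    by (simp add: padic_Cauchy_ring_def)
  have "padic_of_rat p x = \<zero>\<^bsub>padic_field p\<^esub> \<longleftrightarrow> (\<lambda>n. x) \<in> padic_null p"
    unfolding padic_of_rat_def padic_field_def FactRing_def
    using a_rcos_self[OF c] a_rcos_const by auto
  also have "\<dots> \<longleftrightarrow> x = 0"
    using padic_abs_pos[OF assms, of x]
    by (cases "x = 0") (auto simp: padic_null_def LIMSEQ_const_iff)
  finally show ?thesis .
qed

end

theory Submission
  imports Defs "HOL-Number_Theory.Euler_Criterion" "HOL-Computational_Algebra.Squarefree"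
begin

text \<open>
  Put \<open>n = \<parallel>a\<parallel>\<^sup>2\<close> and \<open>m = a\<^sub>1\<^sup>2 + a\<^sub>2\<^sup>2\<close>, after a permutation of coordinates nonzero. Up to square
  factors \<open>tan\<^sup>2 \<theta>\<close> is a positive integer \<open>T\<close>. The plane orthogonal to \<open>a\<close> carries the form
  \<open>\<langle>m, mn\<rangle>\<close>, so \<open>\<theta>\<close> occurs at \<open>a\<close> iff the conic \<open>Z\<^sup>2 = -n X\<^sup>2 + m T Y\<^sup>2\<close> has a rational point.
  Legendre's theorem needs no condition at 2, so this holds iff \<open>(-n, mT)\<^sub>p = 1\<close> for all odd \<open>p\<close>.
  Finally \<open>(-n, m)\<^sub>p = (n, n)\<^sub>p\<close> because \<open>m\<close> is a sum of two squares and \<open>n - m\<close> is a square, while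
  \<open>(-n, T)\<^sub>p = (n, T)\<^sub>p (T, T)\<^sub>p\<close>.
\<close>

section \<open>The Hilbert symbol in terms of rational Cauchy sequences\<close>

text \<open>The symbol is defined by solvability over a quotient ring, whereas the argument needs it
  to be bimultiplicative. So it is evaluated outright at odd \<open>p\<close>: the result,
  \<open>tame_symbol\<close>, inherits multiplicativity from the Legendre symbol. Two facts about
  the completion carry this evaluation: a unit that is a square modulo \<open>p\<close> is a p-adic
  square, and a p-adic solution leaves a primitive integral one modulo \<open>p^2\<close>.

  The prime 2 drops out of the global step for an elementary reason. Apart from being handed on to
  smaller coefficients, the local conditions serve the descent only to give a square root of
  \<open>a\<close> modulo a squarefree \<open>b\<close>, and modulo 2 every integer is a square. The
  real place is settled by \<open>m T > 0\<close>.

  The tangent squared does not separate an angle from its supplement. The sign of the cosine is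
  therefore carried as a separate inequality. It costs nothing in the end, because a point of the
  conic stays on it when the coordinate along \<open>a\<close> changes sign.\<close>

lemma padic_coset_eq_iff:
  assumes "prime p" "padic_Cauchy p f" "padic_Cauchy p g"
  shows "padic_null p +>\<^bsub>padic_Cauchy_ring p\<^esub> f = padic_null p +>\<^bsub>padic_Cauchy_ring p\<^esub> g \<longleftrightarrow>
    (\<lambda>n. f n - g n) \<in> padic_null p"
proof -
  interpret I: ideal "padic_null p" "padic_Cauchy_ring p"
    by (rule padic_null_ideal[OF assms(1)])
  have *: "\<ominus>\<^bsub>padic_Cauchy_ring p\<^esub> g = (\<lambda>n. - g n)"
    using assms by (intro I.minus_equality) (auto simp: padic_Cauchy_ring_def padic_Cauchy_uminus)
  have "f \<ominus>\<^bsub>padic_Cauchy_ring p\<^esub> g = (\<lambda>n. f n - g n)"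
    unfolding a_minus_def * by (simp add: padic_Cauchy_ring_def)
  then show ?thesis
    using I.quotient_eq_iff_same_a_r_cos[OF I.ideal_axioms, of f g] assms by (simp add: padic_Cauchy_ring_def eq_commute)
qed

text \<open>Choosing representatives removes the quotient ring: from here on a p-adic solution is a
  triple of rational Cauchy sequences, and an equation holds up to a null sequence.\<close>

lemma hilbert_symbol_eq_1_iff:
  assumes "prime p"
  shows "hilbert_symbol p x y = 1 \<longleftrightarrow>
    (\<exists>f g h. padic_Cauchy p f \<and> padic_Cauchy p g \<and> padic_Cauchy p h \<and>
       \<not> (f \<in> padic_null p \<and> g \<in> padic_null p \<and> h \<in> padic_null p) \<and>
       (\<lambda>n. (h n)\<^sup>2 - (x * (f n)\<^sup>2 + y * (g n)\<^sup>2)) \<in> padic_null p)"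
proof -
  interpret I: ideal "padic_null p" "padic_Cauchy_ring p"
    by (rule padic_null_ideal[OF assms])
  interpret K: field "padic_field p"
    by (rule padic_field_is_field[OF assms])
  define c where "c = a_r_coset (padic_Cauchy_ring p) (padic_null p)"
  note hom = I.rcos_ring_hom[folded c_def padic_field_def]
  have carr: "carrier (padic_field p) = c ` {f. padic_Cauchy p f}"
    by (auto simp: padic_field_def FactRing_def A_RCOSETS_def' c_def padic_Cauchy_ring_def)
  have closed: "c f \<in> carrier (padic_field p)" if "padic_Cauchy p f" for f
    using that carr by blast
  have R: "carrier (padic_Cauchy_ring p) = {X. padic_Cauchy p X}"
    "f \<oplus>\<^bsub>padic_Cauchy_ring p\<^esub> g = (\<lambda>n. f n + g n)"
    "f \<otimes>\<^bsub>padic_Cauchy_ring p\<^esub> g = (\<lambda>n. f n * g n)" for f g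
    by (simp_all add: padic_Cauchy_ring_def)
  have add: "c f \<oplus>\<^bsub>padic_field p\<^esub> c g = c (\<lambda>n. f n + g n)" if "padic_Cauchy p f" "padic_Cauchy p g" for f g
    using ring_hom_add[OF hom, of f g] that by (simp add: R)
  have mult: "c f \<otimes>\<^bsub>padic_field p\<^esub> c g = c (\<lambda>n. f n * g n)" if "padic_Cauchy p f" "padic_Cauchy p g" for f g
    using ring_hom_mult[OF hom, of f g] that by (simp add: R)
  have rat: "padic_of_rat p r = c (\<lambda>n. r)" for r
    by (simp add: padic_of_rat_def c_def)
  have zero: "\<zero>\<^bsub>padic_field p\<^esub> = c (\<lambda>n. 0)"
    using padic_of_rat_eq_0_iff[OF assms, of 0] rat by simp
  have eq_iff: "c f = c g \<longleftrightarrow> (\<lambda>n. f n - g n) \<in> padic_null p" if "padic_Cauchy p f" "padic_Cauchy p g" for f g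
    using padic_coset_eq_iff[OF assms that] by (simp add: c_def)
  have zero_iff: "c f = \<zero>\<^bsub>padic_field p\<^esub> \<longleftrightarrow> f \<in> padic_null p" if "padic_Cauchy p f" for f
    unfolding zero using eq_iff[OF that, of "\<lambda>n. 0"] by simp
  have sq: "c f [^]\<^bsub>padic_field p\<^esub> (2::nat) = c (\<lambda>n. (f n)\<^sup>2)" if "padic_Cauchy p f" for f
    using mult[OF that that] closed[OF that] by (simp add: numeral_2_eq_2)
  have eqn: "c h [^]\<^bsub>padic_field p\<^esub> (2::nat) =
      padic_of_rat p x \<otimes>\<^bsub>padic_field p\<^esub> c f [^]\<^bsub>padic_field p\<^esub> (2::nat) \<oplus>\<^bsub>padic_field p\<^esub>
      padic_of_rat p y \<otimes>\<^bsub>padic_field p\<^esub> c g [^]\<^bsub>padic_field p\<^esub> (2::nat)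
      \<longleftrightarrow> (\<lambda>n. (h n)\<^sup>2 - (x * (f n)\<^sup>2 + y * (g n)\<^sup>2)) \<in> padic_null p"
    if "padic_Cauchy p f" "padic_Cauchy p g" "padic_Cauchy p h" for f g h
    using that
    by (simp add: sq rat mult add eq_iff padic_Cauchy_mult padic_Cauchy_add assms power2_eq_square)
  have "hilbert_symbol p x y = 1 \<longleftrightarrow> (\<exists>X \<in> carrier (padic_field p). \<exists>Y \<in> carrier (padic_field p). \<exists>Z \<in> carrier (padic_field p).
           (X, Y, Z) \<noteq> (\<zero>\<^bsub>padic_field p\<^esub>, \<zero>\<^bsub>padic_field p\<^esub>, \<zero>\<^bsub>padic_field p\<^esub>) \<and>
           Z [^]\<^bsub>padic_field p\<^esub> (2::nat) =
             padic_of_rat p x \<otimes>\<^bsub>padic_field p\<^esub> X [^]\<^bsub>padic_field p\<^esub> (2::nat) \<oplus>\<^bsub>padic_field p\<^esub>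
             padic_of_rat p y \<otimes>\<^bsub>padic_field p\<^esub> Y [^]\<^bsub>padic_field p\<^esub> (2::nat))"
    by (auto simp: hilbert_symbol_def)
  also have "\<dots> \<longleftrightarrow> (\<exists>f\<in>Collect (padic_Cauchy p). \<exists>g\<in>Collect (padic_Cauchy p). \<exists>h\<in>Collect (padic_Cauchy p).
       \<not> (f \<in> padic_null p \<and> g \<in> padic_null p \<and> h \<in> padic_null p) \<and>
       (\<lambda>n. (h n)\<^sup>2 - (x * (f n)\<^sup>2 + y * (g n)\<^sup>2)) \<in> padic_null p)"
    unfolding carr bex_simps(7)
    by (intro bex_cong[OF refl]) (simp add: zero_iff eqn)
  also have "\<dots> \<longleftrightarrow> (\<exists>f g h. padic_Cauchy p f \<and> padic_Cauchy p g \<and> padic_Cauchy p h \<and>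
       \<not> (f \<in> padic_null p \<and> g \<in> padic_null p \<and> h \<in> padic_null p) \<and>
       (\<lambda>n. (h n)\<^sup>2 - (x * (f n)\<^sup>2 + y * (g n)\<^sup>2)) \<in> padic_null p)"
    by auto
  finally show ?thesis .
qed

lemma hilbert_symbol_cases: "hilbert_symbol p x y = 1 \<or> hilbert_symbol p x y = - 1"
  by (simp add: hilbert_symbol_def)

section \<open>Symmetry and invariance under square factors\<close>

lemma hilbert_symbol_commute:
  assumes "prime p"
  shows "hilbert_symbol p x y = hilbert_symbol p y x"
proof -
  have "hilbert_symbol p y x = 1" if hs: "hilbert_symbol p x y = 1" for x y
  proof -
    obtain f g h where "padic_Cauchy p f" "padic_Cauchy p g" "padic_Cauchy p h"
      "\<not> (f \<in> padic_null p \<and> g \<in> padic_null p \<and> h \<in> padic_null p)"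
      "(\<lambda>n. (h n)\<^sup>2 - (x * (f n)\<^sup>2 + y * (g n)\<^sup>2)) \<in> padic_null p"
      using hs unfolding hilbert_symbol_eq_1_iff[OF assms] by blast
    then show ?thesis
      unfolding hilbert_symbol_eq_1_iff[OF assms]
      by (intro exI[of _ g] exI[of _ f] exI[of _ h]) (auto simp: add.commute)
  qed
  then show ?thesis
    using hilbert_symbol_cases[of p x y] hilbert_symbol_cases[of p y x] by metis
qed

lemma padic_null_cmult_iff:
  assumes "prime p" "c \<noteq> 0"
  shows "(\<lambda>n. c * f n) \<in> padic_null p \<longleftrightarrow> f \<in> padic_null p"
proof
  assume "f \<in> padic_null p"
  then show "(\<lambda>n. c * f n) \<in> padic_null p"
    using padic_null_mult[OF assms(1), of f "\<lambda>n. c"] by (simp add: mult.commute)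
next
  assume "(\<lambda>n. c * f n) \<in> padic_null p"
  then show "f \<in> padic_null p"
    using padic_null_mult[OF assms(1), of "\<lambda>n. c * f n" "\<lambda>n. inverse c"] assms(2) by (simp add: field_simps)
qed

lemma hilbert_symbol_mult_square_left:
  assumes "prime p" "c \<noteq> 0"
  shows "hilbert_symbol p (c\<^sup>2 * x) y = hilbert_symbol p x y"
proof -
  have *: "hilbert_symbol p x y = 1" if c: "c \<noteq> 0" and hs: "hilbert_symbol p (c\<^sup>2 * x) y = 1" for x c
  proof -
    obtain f g h where fgh: "padic_Cauchy p f" "padic_Cauchy p g" "padic_Cauchy p h"
      "\<not> (f \<in> padic_null p \<and> g \<in> padic_null p \<and> h \<in> padic_null p)"
      "(\<lambda>n. (h n)\<^sup>2 - (c\<^sup>2 * x * (f n)\<^sup>2 + y * (g n)\<^sup>2)) \<in> padic_null p"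
      using hs unfolding hilbert_symbol_eq_1_iff[OF assms(1)] by blast
    have "padic_Cauchy p (\<lambda>n. c * f n)"
      by (rule padic_Cauchy_mult) (use assms fgh in auto)
    then show ?thesis
      unfolding hilbert_symbol_eq_1_iff[OF assms(1)] using fgh
      by (intro exI[of _ "\<lambda>n. c * f n"] exI[of _ g] exI[of _ h])
         (auto simp: padic_null_cmult_iff assms(1) c power_mult_distrib mult_ac)
  qed
  \<comment> \<open>The converse of \<open>*\<close> is \<open>*\<close> itself, used with
    \<open>inverse c\<close> in place of \<open>c\<close>.\<close>
  have "(inverse c)\<^sup>2 * (c\<^sup>2 * x) = x"
    using assms by (simp add: field_simps)
  then have "hilbert_symbol p ((inverse c)\<^sup>2 * (c\<^sup>2 * x)) y = hilbert_symbol p x y"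
    by (rule arg_cong)
  then show ?thesis
    using *[of c x] *[of "inverse c" "c\<^sup>2 * x"] assms
      hilbert_symbol_cases[of p x y] hilbert_symbol_cases[of p "c\<^sup>2 * x" y] by auto
qed

lemma hilbert_symbol_mult_square_right:
  assumes "prime p" "c \<noteq> 0"
  shows "hilbert_symbol p x (c\<^sup>2 * y) = hilbert_symbol p x y"
  using hilbert_symbol_mult_square_left[OF assms] hilbert_symbol_commute[OF assms(1)] by metis

section \<open>Integral approximations and p-adic square roots\<close>

lemma padic_abs_of_int:
  assumes "prime p" "k \<noteq> 0"
  shows "padic_abs p (of_int k) = 1 / real p ^ multiplicity (int p) k"
  using assms padic_val_divide[OF assms(1,2), of 1]
  by (simp add: padic_abs_def power_int_minus divide_inverse)

lemma padic_abs_of_int_le_iff: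
  assumes "prime p"
  shows "padic_abs p (of_int k) \<le> 1 / real p ^ j \<longleftrightarrow> int p ^ j dvd k"
proof (cases "k = 0")
  case False
  have p: "real p > 1" "\<not> is_unit (int p)"
    using prime_gt_1_nat[OF assms] by auto
  have "padic_abs p (of_int k) \<le> 1 / real p ^ j \<longleftrightarrow> real p ^ j \<le> real p ^ multiplicity (int p) k"
    using p by (simp add: padic_abs_of_int[OF assms False] field_simps)
  also have "\<dots> \<longleftrightarrow> j \<le> multiplicity (int p) k"
    using p by simp
  also have "\<dots> \<longleftrightarrow> int p ^ j dvd k"
    using False p by (simp add: power_dvd_iff_le_multiplicity)
  finally show ?thesis .
qed (use assms in auto)

text \<open>A single late term of the sequences suffices. It is a rational factor \<open>t\<close>
  times a primitive integer triple. One of the sequences stays at absolute value at least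
  \<open>c\<close>, so \<open>t\<close> does too, and dividing the equation by \<open>t^2\<close>
  keeps the error small. The modulus \<open>p^2\<close> is what the arguments against solvability
  below consume.\<close>

lemma hilbert_symbol_imp_cong:
  fixes A B :: int
  assumes p: "prime p" and hs: "hilbert_symbol p (of_int A) (of_int B) = 1"
  obtains x y z :: int where "\<not> (int p dvd x \<and> int p dvd y \<and> int p dvd z)"
    "int p ^ 2 dvd z\<^sup>2 - (A * x\<^sup>2 + B * y\<^sup>2)"
proof -
  obtain f g h where fgh: "padic_Cauchy p f" "padic_Cauchy p g" "padic_Cauchy p h"
    and nz: "\<not> (f \<in> padic_null p \<and> g \<in> padic_null p \<and> h \<in> padic_null p)"
    and null: "(\<lambda>n. (h n)\<^sup>2 - (of_int A * (f n)\<^sup>2 + of_int B * (g n)\<^sup>2)) \<in> padic_null p"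
    using hs unfolding hilbert_symbol_eq_1_iff[OF p] by blast
  obtain k where k: "k \<in> {f, g, h}" "padic_Cauchy p k" "k \<notin> padic_null p"
    using nz fgh by blast
  obtain c N where c: "c > 0" "\<And>n. n \<ge> N \<Longrightarrow> padic_abs p (k n) \<ge> c"
    using padic_Cauchy_away_from_0[OF p k(2,3)] by blast
  have p0: "real p > 0"
    using prime_gt_0_nat[OF p] by simp
  obtain M where M: "\<And>n. n \<ge> M \<Longrightarrow>
      padic_abs p ((h n)\<^sup>2 - (of_int A * (f n)\<^sup>2 + of_int B * (g n)\<^sup>2)) < c\<^sup>2 / real p ^ 2"
    using null c p0 unfolding padic_null_iff by (meson divide_pos_pos zero_less_power)
  define n where "n = max M N"
  obtain a b d1 where 1: "f n = of_int a / of_int d1" "g n = of_int b / of_int d1" "d1 \<noteq> 0"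
    by (rule rat_common_denom)
  obtain e d2 d where 2: "h n = of_int e / of_int d" "1 / of_int d1 = of_int d2 / (of_int d :: rat)" "d \<noteq> 0"
    by (rule rat_common_denom)
  have f: "f n = of_int (a * d2) / of_int d" and g: "g n = of_int (b * d2) / of_int d"
    using 1 2(2) by (metis (no_types, opaque_lifting) mult.right_neutral of_int_mult times_divide_eq_right)+
  define G where "G = gcd (a * d2) (gcd (b * d2) e)"
  have kn: "k n \<noteq> 0"
    using c(1) c(2)[of n] by (auto simp: n_def)
  have "a * d2 \<noteq> 0 \<or> b * d2 \<noteq> 0 \<or> e \<noteq> 0"
    using kn k(1) f g 2(1) by auto
  then have G0: "G \<noteq> 0"
    by (auto simp: G_def)
  obtain x y z where xyz: "a * d2 = G * x" "b * d2 = G * y" "e = G * z"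
    by (metis G_def dvd_def gcd_dvd1 gcd_dvd2 dvd_trans)
  define t :: rat where "t = of_int G / of_int d"
  have t0: "t \<noteq> 0"
    using G0 2 by (simp add: t_def)
  have fghn: "f n = t * of_int x" "g n = t * of_int y" "h n = t * of_int z"
    using f g 2(1) xyz by (auto simp: t_def)
  define S where "S = z\<^sup>2 - (A * x\<^sup>2 + B * y\<^sup>2)"
  have "(h n)\<^sup>2 - (of_int A * (f n)\<^sup>2 + of_int B * (g n)\<^sup>2) = t\<^sup>2 * of_int S"
    unfolding fghn S_def by (simp add: algebra_simps power2_eq_square)
  then have 3: "(padic_abs p t)\<^sup>2 * padic_abs p (of_int S) < c\<^sup>2 / real p ^ 2"
    using M[of n] by (simp add: n_def padic_abs_mult[OF p] power2_eq_square)
  have int1: "padic_abs p (of_int j) \<le> 1" for j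
    using padic_abs_of_int_le_iff[OF p, of j 0] by simp
  have "padic_abs p (k n) \<le> padic_abs p t"
    using k(1) int1 by (auto simp: fghn padic_abs_mult[OF p] mult_left_le)
  then have "c \<le> padic_abs p t"
    using c(2)[of n] by (simp add: n_def)
  then have "c\<^sup>2 \<le> (padic_abs p t)\<^sup>2"
    using c(1) by (intro power_mono) auto
  then have "c\<^sup>2 / real p ^ 2 \<le> (padic_abs p t)\<^sup>2 * (1 / real p ^ 2)"
    using divide_right_mono[of "c\<^sup>2" "(padic_abs p t)\<^sup>2" "real p ^ 2"] by simp
  then have "(padic_abs p t)\<^sup>2 * padic_abs p (of_int S) < (padic_abs p t)\<^sup>2 * (1 / real p ^ 2)"
    using 3 by (rule less_le_trans[rotated])
  then have "padic_abs p (of_int S) \<le> 1 / real p ^ 2"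
    using padic_abs_pos[OF p t0] by (subst (asm) mult_less_cancel_left_pos) auto
  then have S: "int p ^ 2 dvd S"
    using padic_abs_of_int_le_iff[OF p] by blast
  have "\<not> (int p dvd x \<and> int p dvd y \<and> int p dvd z)"
  proof
    assume "int p dvd x \<and> int p dvd y \<and> int p dvd z"
    then have "G * int p dvd gcd (a * d2) (gcd (b * d2) e)"
      unfolding xyz by simp
    then have "G * int p dvd G * 1"
      by (simp add: G_def)
    then show False
      using G0 prime_gt_1_nat[OF p] by (simp del: mult_1_right)
  qed
  then show ?thesis
    using that S by (simp add: S_def)
qed

text \<open>Hensel's lemma for \<open>X^2 - u\<close>: the approximate root \<open>w\<close> is a
  unit and \<open>p\<close> is odd, so the derivative \<open>2 * w\<close> is invertible modulo
  \<open>p\<close>. Gaining one power of \<open>p\<close> per step is enough for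
  convergence.\<close>

lemma padic_sqrt_exists:
  fixes u w :: int
  assumes p: "prime p" "odd p" and u: "\<not> int p dvd u" and w: "int p dvd w\<^sup>2 - u"
  obtains f where "padic_Cauchy p f" "(\<lambda>n. (f n)\<^sup>2 - of_int u) \<in> padic_null p" "f \<notin> padic_null p"
proof -
  have pp: "prime (int p)" using p by simp
  have "\<not> int p dvd w"
    using u w dvd_diff[of "int p" "w\<^sup>2" "w\<^sup>2 - u"] by (auto simp: power2_eq_square)
  moreover have "\<not> int p dvd 2"
  proof
    assume "int p dvd 2"
    then have "p dvd 2" by presburger
    then have "p \<le> 2" by (simp add: dvd_imp_le)
    then show False using p prime_ge_2_nat[of p] by simp
  qed
  ultimately have "coprime (2 * w) (int p)"
    using pp by (metis coprime_commute prime_dvd_mult_iff prime_imp_coprime)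
  then obtain i where i: "[2 * w * i = 1] (mod int p)"
    using cong_solve_coprime_int by blast
  \<comment> \<open>Newton iteration with the fixed approximate inverse \<open>i\<close> of the derivative \<open>2 w\<close>.\<close>
  define s where "s = rec_nat w (\<lambda>_ x. x - (x\<^sup>2 - u) * i)"
  have s0: "s 0 = w" and sS: "s (Suc n) = s n - ((s n)\<^sup>2 - u) * i" for n
    by (simp_all add: s_def)
  have pow: "int p ^ m dvd k" if "int p ^ Suc n dvd k" "m \<le> n" for m n k
    using that le_imp_power_dvd[of m "Suc n" "int p"] dvd_trans by (metis le_SucI)
  have inv: "int p ^ Suc n dvd (s n)\<^sup>2 - u \<and> int p dvd s n - w" for n
  proof (induction n)
    case 0
    then show ?case using w by (simp add: s0)
  next
    case (Suc n)
    define e where "e = (s n)\<^sup>2 - u"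
    have e: "int p ^ Suc n dvd e" and sn: "int p dvd s n - w"
      using Suc by (auto simp: e_def)
    have pe: "int p dvd e"
      using e by (simp add: dvd_mult_left)
    have "int p dvd 1 - 2 * w * i"
      using i by (metis cong_iff_dvd_diff cong_sym)
    then have "int p dvd (1 - 2 * w * i) - (s n - w) * (2 * i)"
      using sn by (rule dvd_diff[OF _ dvd_mult2])
    then have 1: "int p dvd 1 - 2 * s n * i"
      by (simp add: algebra_simps)
    \<comment> \<open>Both terms gain a factor \<open>p\<close> over the old error \<open>e\<close>:
      the first because \<open>s n\<close> is still congruent to \<open>w\<close>, so that
      \<open>i\<close> inverts \<open>2 * s n\<close> modulo \<open>p\<close>, the second because
      \<open>e\<close> itself is divisible by \<open>p\<close>.\<close>
    have "(s (Suc n))\<^sup>2 - u = e * (1 - 2 * s n * i) + e * e * i\<^sup>2"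
      by (simp add: sS e_def algebra_simps power2_eq_square)
    moreover have "int p ^ Suc n * int p dvd e * (1 - 2 * s n * i)"
      using e 1 by (rule mult_dvd_mono)
    moreover have "int p ^ Suc n * int p dvd e * e * i\<^sup>2"
      using e pe by (intro dvd_mult2 mult_dvd_mono)
    ultimately have "int p ^ Suc (Suc n) dvd (s (Suc n))\<^sup>2 - u"
      by (simp add: mult.commute)
    moreover have "int p dvd (s n - w) - e * i"
      using sn pe by (rule dvd_diff[OF _ dvd_mult2])
    then have "int p dvd s (Suc n) - w"
      by (simp add: sS e_def algebra_simps)
    ultimately show ?case by blast
  qed
  have step: "int p ^ m dvd s n - s m" if "m \<le> n" for m n
    using that
  proof (induction n rule: dec_induct)
    case (step n)
    have "int p ^ m dvd (s n)\<^sup>2 - u"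
      using inv[of n] step.hyps by (blast intro: pow)
    then have "int p ^ m dvd (s n - s m) - ((s n)\<^sup>2 - u) * i"
      using dvd_diff[OF step.IH dvd_mult2] by blast
    then show ?case by (simp add: sS algebra_simps)
  qed simp
  have lim: "\<exists>N. 1 / real p ^ N < e" if "e > 0" for e
    using real_arch_pow_inv[OF that, of "1 / real p"] prime_gt_1_nat[OF p(1)]
    by (simp add: power_one_over)
  have "padic_Cauchy p (\<lambda>n. of_int (s n))"
    unfolding padic_Cauchy_def
  proof (intro allI impI)
    fix e :: real assume "e > 0"
    then obtain N where N: "1 / real p ^ N < e" using lim by blast
    have "padic_abs p (of_int (s m) - of_int (s n)) < e" if "m \<ge> N" "n \<ge> N" for m n
    proof -
      have "int p ^ N dvd (s m - s N) - (s n - s N)"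
        using dvd_diff[OF step[OF that(1)] step[OF that(2)]] .
      then have "padic_abs p (of_int (s m - s n)) \<le> 1 / real p ^ N"
        unfolding padic_abs_of_int_le_iff[OF p(1)] by simp
      then show ?thesis using N by simp
    qed
    then show "\<exists>N. \<forall>m\<ge>N. \<forall>n\<ge>N. padic_abs p (of_int (s m) - of_int (s n)) < e"
      by blast
  qed
  moreover have "(\<lambda>n. (of_int (s n))\<^sup>2 - of_int u) \<in> padic_null p"
    unfolding padic_null_iff
  proof (intro allI impI)
    fix e :: real assume "e > 0"
    then obtain N where N: "1 / real p ^ N < e" using lim by blast
    have "padic_abs p ((of_int (s n))\<^sup>2 - of_int u) < e" if "n \<ge> N" for n
    proof -
      have "int p ^ N dvd (s n)\<^sup>2 - u"
        using inv[of n] that by (blast intro: pow)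
      then have "padic_abs p (of_int ((s n)\<^sup>2 - u)) \<le> 1 / real p ^ N"
        unfolding padic_abs_of_int_le_iff[OF p(1)] .
      then show ?thesis using N by simp
    qed
    then show "\<exists>N. \<forall>n\<ge>N. padic_abs p ((of_int (s n))\<^sup>2 - of_int u) < e"
      by blast
  qed
  moreover have "(\<lambda>n. of_int (s n)) \<notin> padic_null p"
  proof
    assume "(\<lambda>n. of_int (s n)) \<in> padic_null p"
    moreover have "1 / real p ^ 1 > 0"
      using prime_gt_0_nat[OF p(1)] by simp
    ultimately obtain n where "padic_abs p (of_int (s n)) < 1 / real p ^ 1"
      unfolding padic_null_iff by blast
    then have "int p dvd s n"
      using padic_abs_of_int_le_iff[OF p(1), of "s n" 1] by simp
    then have "int p dvd w"
      using inv[of n] dvd_diff[of "int p" "s n" "s n - w"] by simp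
    then show False using \<open>\<not> int p dvd w\<close> by simp
  qed
  ultimately show ?thesis
    using that[of "\<lambda>n. of_int (s n)"] by simp
qed

section \<open>The Hilbert symbol at an odd prime\<close>

lemma Legendre_mult:
  assumes "prime p" "odd p"
  shows "Legendre (a * b) (int p) = Legendre a (int p) * Legendre b (int p)"
proof -
  have p: "p > 2"
    using assms prime_ge_2_nat[of p] by (metis dvd_refl le_neq_implies_less)
  \<comment> \<open>Euler's criterion yields only a congruence modulo \<open>p\<close>. It is an
    equality because both sides lie in {-1, 0, 1} and \<open>p > 2\<close>.\<close>
  have "[Legendre (a * b) (int p) = Legendre a (int p) * Legendre b (int p)] (mod int p)"
    using cong_trans[OF euler_criterion[OF assms(1) p, of "a * b"]]
      cong_mult[OF euler_criterion[OF assms(1) p, of a] euler_criterion[OF assms(1) p, of b]]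
    by (metis cong_sym power_mult_distrib)
  then have "int p dvd Legendre (a * b) (int p) - Legendre a (int p) * Legendre b (int p)"
    by (simp add: cong_iff_dvd_diff)
  moreover have "\<bar>Legendre (a * b) (int p) - Legendre a (int p) * Legendre b (int p)\<bar> < int p"
    using p by (auto simp: Legendre_def)
  ultimately show ?thesis
    using zdvd_not_zless[of "\<bar>Legendre (a * b) (int p) - Legendre a (int p) * Legendre b (int p)\<bar>" "int p"]
    by (cases "Legendre (a * b) (int p) = Legendre a (int p) * Legendre b (int p)") auto
qed

lemma Legendre_eq_1_iff:
  assumes "\<not> int p dvd a"
  shows "Legendre a (int p) = 1 \<longleftrightarrow> (\<exists>w. int p dvd w\<^sup>2 - a)"
proof -
  have "\<not> [a = 0] (mod int p)"
    using assms by (simp add: cong_0_iff)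
  then show ?thesis
    by (simp add: Legendre_def QuadRes_def cong_iff_dvd_diff)
qed

lemma Legendre_cases:
  assumes "\<not> int p dvd a"
  shows "Legendre a (int p) = 1 \<or> Legendre a (int p) = - 1"
  using assms by (auto simp: Legendre_def cong_0_iff)

lemma Legendre_cong:
  "[a = b] (mod m) \<Longrightarrow> Legendre a m = Legendre b m"
  unfolding Legendre_def QuadRes_def by (simp add: cong_def)

definition unit_part :: "nat \<Rightarrow> int \<Rightarrow> int" where
  "unit_part p a = a div int p ^ multiplicity (int p) a"

text \<open>The classical formula for \<open>(a, b)\<^sub>p\<close> at odd \<open>p\<close>; bimultiplicative by inspection.\<close>

definition tame_symbol :: "nat \<Rightarrow> int \<Rightarrow> int \<Rightarrow> int" where
  "tame_symbol p a b =
     Legendre (- 1) (int p) ^ (multiplicity (int p) a * multiplicity (int p) b) *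
     Legendre (unit_part p a) (int p) ^ multiplicity (int p) b *
     Legendre (unit_part p b) (int p) ^ multiplicity (int p) a"

lemma unit_part_decompose: "a = int p ^ multiplicity (int p) a * unit_part p a"
  by (simp add: unit_part_def multiplicity_dvd)

lemma not_dvd_unit_part:
  assumes "prime p" "a \<noteq> 0"
  shows "\<not> int p dvd unit_part p a"
  unfolding unit_part_def using assms prime_gt_1_nat[of p] by (intro multiplicity_decompose) auto

lemma not_dvd_prime_mult:
  assumes "prime p" "\<not> int p dvd a" "\<not> int p dvd b"
  shows "\<not> int p dvd a * b"
  using assms by (simp add: prime_dvd_mult_iff)

lemma unit_part_mult:
  assumes "prime p" "a \<noteq> 0" "b \<noteq> 0"
  shows "unit_part p (a * b) = unit_part p a * unit_part p b"
proof -
  have "multiplicity (int p) (a * b) = multiplicity (int p) a + multiplicity (int p) b"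
    using assms by (simp add: prime_elem_multiplicity_mult_distrib)
  then show ?thesis
    unfolding unit_part_def by (simp add: power_add div_mult_div_if_dvd multiplicity_dvd)
qed

lemma tame_symbol_commute: "tame_symbol p a b = tame_symbol p b a"
  by (simp add: tame_symbol_def mult_ac)

lemma tame_symbol_mult_left:
  assumes "prime p" "odd p" "a \<noteq> 0" "b \<noteq> 0"
  shows "tame_symbol p (a * b) c = tame_symbol p a c * tame_symbol p b c"
  using assms
  by (simp add: tame_symbol_def unit_part_mult Legendre_mult prime_elem_multiplicity_mult_distrib
      power_add power_mult_distrib algebra_simps)

lemma tame_symbol_mult_right:
  assumes "prime p" "odd p" "b \<noteq> 0" "c \<noteq> 0"
  shows "tame_symbol p a (b * c) = tame_symbol p a b * tame_symbol p a c"
  using tame_symbol_mult_left[OF assms] by (simp add: tame_symbol_commute)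

lemma tame_symbol_cases:
  assumes "prime p" "a \<noteq> 0" "b \<noteq> 0"
  shows "tame_symbol p a b = 1 \<or> tame_symbol p a b = - 1"
proof -
  have "\<not> int p dvd - 1"
    using prime_gt_1_nat[OF assms(1)] by simp
  then have L: "\<bar>Legendre (- 1) (int p)\<bar> = 1" "\<bar>Legendre (unit_part p a) (int p)\<bar> = 1"
    "\<bar>Legendre (unit_part p b) (int p)\<bar> = 1"
    using Legendre_cases[of p "- 1"] Legendre_cases[OF not_dvd_unit_part[OF assms(1,2)]]
      Legendre_cases[OF not_dvd_unit_part[OF assms(1,3)]] by auto
  have "\<bar>tame_symbol p a b\<bar> = 1"
    unfolding tame_symbol_def by (simp only: abs_mult power_abs L) simp
  then show ?thesis by linarith
qed

lemma tame_symbol_square_left: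
  assumes "prime p" "odd p" "c \<noteq> 0" "a \<noteq> 0" "b \<noteq> 0"
  shows "tame_symbol p (c\<^sup>2 * a) b = tame_symbol p a b"
  using tame_symbol_mult_left[OF assms(1,2), of "c\<^sup>2" a b] tame_symbol_mult_left[OF assms(1,2), of c c b]
    tame_symbol_cases[OF assms(1,3,5)] assms by (auto simp: power2_eq_square)

lemma padic_null_const_iff:
  assumes "prime p"
  shows "(\<lambda>n. c) \<in> padic_null p \<longleftrightarrow> c = 0"
  using padic_abs_pos[OF assms, of c] by (cases "c = 0") (auto simp: padic_null_def LIMSEQ_const_iff)

section \<open>Values of the symbol for valuations 0 and 1\<close>

lemma hilbert_symbol_rational_point:
  assumes "prime p" "(x, y, z) \<noteq> (0, 0, 0)" "z\<^sup>2 = a * x\<^sup>2 + b * y\<^sup>2"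
  shows "hilbert_symbol p a b = 1"
  unfolding hilbert_symbol_eq_1_iff[OF assms(1)]
  using assms
  by (intro exI[of _ "\<lambda>n. x"] exI[of _ "\<lambda>n. y"] exI[of _ "\<lambda>n. z"]) (auto simp: padic_null_const_iff)

text \<open>The value of the form at the constants \<open>x\<close>, \<open>y\<close> is a unit and
  a square modulo \<open>p\<close>, hence a p-adic square; its root is the third coordinate of a
  solution.\<close>

lemma hilbert_symbol_represents_square:
  fixes a b x y :: int
  assumes p: "prime p" "odd p" and L: "Legendre (a * x\<^sup>2 + b * y\<^sup>2) (int p) = 1"
  shows "hilbert_symbol p (of_int a) (of_int b) = 1"
proof -
  define u where "u = a * x\<^sup>2 + b * y\<^sup>2"
  have "\<not> int p dvd u"
    using L by (auto simp: u_def Legendre_def cong_0_iff split: if_splits)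
  moreover obtain w where "int p dvd w\<^sup>2 - u"
    using Legendre_eq_1_iff[OF calculation] L u_def by auto
  ultimately obtain f where "padic_Cauchy p f" "(\<lambda>n. (f n)\<^sup>2 - of_int u) \<in> padic_null p" "f \<notin> padic_null p"
    using padic_sqrt_exists[OF p] by metis
  then show ?thesis
    unfolding hilbert_symbol_eq_1_iff[OF p(1)]
    by (intro exI[of _ "\<lambda>n. of_int x"] exI[of _ "\<lambda>n. of_int y"] exI[of _ f]) (auto simp: u_def)
qed

text \<open>Take the least nonresidue \<open>k\<close>. It exceeds 1, so \<open>k - 1\<close> is a
  nonzero residue \<open>x^2\<close>.\<close>

lemma exists_square_plus_1_nonresidue:
  assumes p: "prime p" "odd p" and u: "\<not> int p dvd u" "Legendre u (int p) = - 1"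
  obtains x where "Legendre (x\<^sup>2 + 1) (int p) = - 1"
proof -
  have p1: "int p > 1"
    using prime_gt_1_nat[OF p(1)] by simp
  define P where "P k \<longleftrightarrow> Legendre (int k) (int p) = - 1" for k
  have "[int (nat (u mod int p)) = u] (mod int p)"
    using p1 by (simp add: cong_def)
  then have "P (nat (u mod int p))"
    using u(2) Legendre_cong unfolding P_def by metis
  moreover have "nat (u mod int p) < p"
    using p1 by (simp add: nat_less_iff)
  ultimately obtain k where k: "P k" "\<And>j. j < k \<Longrightarrow> \<not> P j" "k < p"
    using LeastI[of P] not_less_Least[of _ P] by (metis Least_le le_less_trans)
  have Legendre_0: "Legendre 0 (int p) = 0"
    by (simp add: Legendre_def)
  have "\<exists>w. int p dvd w\<^sup>2 - 1"
    by (rule exI[of _ 1]) simp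
  then have Legendre_1: "Legendre 1 (int p) = 1"
    using Legendre_eq_1_iff[of p 1] p1 by simp
  have "k \<noteq> 0" "k \<noteq> 1"
    using k(1) Legendre_1 Legendre_0 unfolding P_def by (intro notI; simp)+
  then have nd: "\<not> int p dvd int (k - 1)"
    using k(3) by (auto dest: zdvd_imp_le)
  then have "Legendre (int (k - 1)) (int p) = 1"
    using Legendre_cases[OF nd] k(2)[of "k - 1"] \<open>k \<noteq> 0\<close> by (auto simp: P_def)
  then obtain x where "int p dvd x\<^sup>2 - int (k - 1)"
    using Legendre_eq_1_iff[OF nd] by blast
  then have "[x\<^sup>2 + 1 = int k] (mod int p)"
    using \<open>k \<noteq> 0\<close> by (simp add: cong_iff_dvd_diff of_nat_diff algebra_simps)
  then show ?thesis
    using that k(1) Legendre_cong unfolding P_def by metis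
qed

text \<open>If one coefficient is a residue, it is itself a square value of the form. For two
  nonresidues their product is a residue, and a value of the form must be found that is nonresidue
  times nonresidue times square.\<close>

lemma hilbert_symbol_units:
  assumes p: "prime p" "odd p" and uv: "\<not> int p dvd u" "\<not> int p dvd v"
  shows "hilbert_symbol p (of_int u) (of_int v) = 1"
proof (cases "Legendre u (int p) = 1 \<or> Legendre v (int p) = 1")
  case True
  then show ?thesis
    using hilbert_symbol_represents_square[OF p, of u 1 v 0]
      hilbert_symbol_represents_square[OF p, of u 0 v 1] by auto
next
  case False
  then have L: "Legendre u (int p) = - 1" "Legendre v (int p) = - 1"
    using Legendre_cases uv by blast+
  then have "Legendre (u * v) (int p) = 1"
    by (simp add: Legendre_mult p)
  then obtain w where w: "int p dvd w\<^sup>2 - u * v"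
    using Legendre_eq_1_iff not_dvd_prime_mult[OF p(1) uv] by blast
  have "\<not> int p dvd w"
    using w not_dvd_prime_mult[OF p(1) uv] dvd_diff[of "int p" "w\<^sup>2" "w\<^sup>2 - u * v"]
    by (auto simp: power2_eq_square)
  then have w1: "Legendre w (int p) * Legendre w (int p) = 1"
    using Legendre_cases by fastforce
  obtain x where x: "Legendre (x\<^sup>2 + 1) (int p) = - 1"
    using exists_square_plus_1_nonresidue[OF p uv(1) L(1)] .
  \<comment> \<open>Since \<open>w^2\<close> is congruent to \<open>u * v\<close>, the summand
    \<open>v * u^2\<close> is congruent to \<open>u * w^2\<close>, and \<open>u * w^2\<close> can be
    factored out of the value at \<open>x * w\<close> and \<open>u\<close>.\<close>
  have "int p dvd (w\<^sup>2 - u * v) * - u"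
    using w by (rule dvd_mult2)
  then have "[u * (x * w)\<^sup>2 + v * u\<^sup>2 = u * (w * w) * (x\<^sup>2 + 1)] (mod int p)"
    by (simp add: cong_iff_dvd_diff algebra_simps power2_eq_square)
  then have "Legendre (u * (x * w)\<^sup>2 + v * u\<^sup>2) (int p) = Legendre (u * (w * w) * (x\<^sup>2 + 1)) (int p)"
    by (rule Legendre_cong)
  also have "\<dots> = 1"
    using x L w1 by (simp add: Legendre_mult p)
  finally show ?thesis
    by (rule hilbert_symbol_represents_square[OF p])
qed

text \<open>For a residue \<open>u\<close> the point X = 1, Y = 0 works. Otherwise reduction modulo
  \<open>p\<close> forces \<open>p\<close> to divide \<open>x\<close> and \<open>z\<close>, and then
  reduction modulo \<open>p^2\<close> forces it to divide \<open>y\<close>, against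
  primitivity.\<close>

lemma hilbert_symbol_unit_prime:
  assumes p: "prime p" "odd p" and uv: "\<not> int p dvd u" "\<not> int p dvd v"
  shows "hilbert_symbol p (of_int u) (of_int (int p * v)) = Legendre u (int p)"
proof (cases "Legendre u (int p) = 1")
  case True
  then show ?thesis
    using hilbert_symbol_represents_square[OF p, of u 1 "int p * v" 0] by auto
next
  case False
  have "hilbert_symbol p (of_int u) (of_int (int p * v)) \<noteq> 1"
  proof
    assume "hilbert_symbol p (of_int u) (of_int (int p * v)) = 1"
    then obtain x y z where xyz: "\<not> (int p dvd x \<and> int p dvd y \<and> int p dvd z)"
      and d: "int p ^ 2 dvd z\<^sup>2 - (u * x\<^sup>2 + int p * v * y\<^sup>2)"
      using hilbert_symbol_imp_cong[OF p(1)] by blast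
    have pp: "prime (int p)" using p by simp
    have "int p dvd z\<^sup>2 - (u * x\<^sup>2 + int p * v * y\<^sup>2)"
      using d by (auto simp: power2_eq_square dest: dvd_mult_left)
    then have "int p dvd z\<^sup>2 - (u * x\<^sup>2 + int p * v * y\<^sup>2) + int p * (v * y\<^sup>2)"
      by (rule dvd_add) simp
    then have 1: "int p dvd z\<^sup>2 - u * x\<^sup>2"
      by (simp add: algebra_simps)
    \<comment> \<open>If \<open>x\<close> were a unit, \<open>u * x^2\<close> being congruent to
      \<open>z^2\<close> would make \<open>u\<close> a residue.\<close>
    have px: "int p dvd x"
    proof (rule ccontr)
      assume nx: "\<not> int p dvd x"
      then have x1: "Legendre x (int p) * Legendre x (int p) = 1"
        using Legendre_cases by fastforce
      have n: "\<not> int p dvd u * x\<^sup>2"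
        using not_dvd_prime_mult[OF p(1)] nx uv by (simp add: power2_eq_square)
      have "Legendre (u * x\<^sup>2) (int p) = 1"
        using Legendre_eq_1_iff[OF n] 1 by blast
      then show False
        using False x1 by (simp add: Legendre_mult p power2_eq_square)
    qed
    then have "int p dvd (z\<^sup>2 - u * x\<^sup>2) + u * x\<^sup>2"
      by (intro dvd_add 1) (simp add: power2_eq_square)
    then have pz: "int p dvd z"
      using pp by (simp add: prime_dvd_power_iff)
    have "int p ^ 2 dvd z\<^sup>2 - u * x\<^sup>2"
      using px pz by (intro dvd_diff dvd_mult) auto
    then have "int p ^ 2 dvd (z\<^sup>2 - u * x\<^sup>2) - (z\<^sup>2 - (u * x\<^sup>2 + int p * v * y\<^sup>2))"
      using d by (rule dvd_diff)
    then have "int p * int p dvd int p * (v * y\<^sup>2)"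
      by (simp add: power2_eq_square algebra_simps)
    then have "int p dvd v * y\<^sup>2"
      using prime_gt_0_nat[OF p(1)] by simp
    then have "int p dvd y"
      using pp uv(2) by (simp add: prime_dvd_mult_iff prime_dvd_power_iff)
    then show False
      using xyz px pz by blast
  qed
  then show ?thesis
    using False Legendre_cases[OF uv(1)] hilbert_symbol_cases by metis
qed

lemma hilbert_symbol_prime_prime:
  assumes p: "prime p" "odd p" and uv: "\<not> int p dvd u" "\<not> int p dvd v"
  shows "hilbert_symbol p (of_int (int p * u)) (of_int (int p * v)) = Legendre (- (u * v)) (int p)"
proof -
  have n: "\<not> int p dvd - (u * v)"
    using not_dvd_prime_mult[OF p(1) uv] by simp
  have u0: "u \<noteq> 0" using uv by auto
  show ?thesis
  proof (cases "Legendre (- (u * v)) (int p) = 1")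
    case True
    then obtain w where "int p dvd w\<^sup>2 - - (u * v)"
      using Legendre_eq_1_iff[OF n] by blast
    then obtain f where f: "padic_Cauchy p f" "(\<lambda>n. (f n)\<^sup>2 - of_int (- (u * v))) \<in> padic_null p"
      "f \<notin> padic_null p"
      using padic_sqrt_exists[OF p n] by metis
    have "(\<lambda>n. - (of_int (int p * u)) * ((f n)\<^sup>2 - of_int (- (u * v)))) \<in> padic_null p"
      using f(2) padic_null_cmult_iff[OF p(1), of "- (of_int (int p * u))"] u0 prime_gt_0_nat[OF p(1)]
      by auto
    \<comment> \<open>A solution with Z = 0: for \<open>f\<close> a square root of
      \<open>- (u * v)\<close>, the pair \<open>f\<close>, \<open>u\<close> is isotropic for the
      form with coefficients \<open>u\<close>, \<open>v\<close>.\<close>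
    then have "(\<lambda>n. 0\<^sup>2 - (of_int (int p * u) * (f n)\<^sup>2 + of_int (int p * v) * (of_int u)\<^sup>2)) \<in> padic_null p"
      by (simp add: algebra_simps power2_eq_square)
    then have "hilbert_symbol p (of_int (int p * u)) (of_int (int p * v)) = 1"
      unfolding hilbert_symbol_eq_1_iff[OF p(1)] using f
      by (intro exI[of _ f] exI[of _ "\<lambda>n. of_int u"] exI[of _ "\<lambda>n. 0"]) auto
    then show ?thesis using True by simp
  next
    case False
    have "hilbert_symbol p (of_int (int p * u)) (of_int (int p * v)) \<noteq> 1"
    proof
      assume "hilbert_symbol p (of_int (int p * u)) (of_int (int p * v)) = 1"
      then obtain x y z where xyz: "\<not> (int p dvd x \<and> int p dvd y \<and> int p dvd z)"
        and d: "int p ^ 2 dvd z\<^sup>2 - (int p * u * x\<^sup>2 + int p * v * y\<^sup>2)"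
        using hilbert_symbol_imp_cong[OF p(1)] by blast
      have pp: "prime (int p)" using p by simp
      have "int p dvd z\<^sup>2 - (int p * u * x\<^sup>2 + int p * v * y\<^sup>2)"
        using d by (auto simp: power2_eq_square dest: dvd_mult_left)
      then have "int p dvd z\<^sup>2 - (int p * u * x\<^sup>2 + int p * v * y\<^sup>2) + int p * (u * x\<^sup>2 + v * y\<^sup>2)"
        by (rule dvd_add) simp
      then have pz: "int p dvd z"
        using pp by (simp add: algebra_simps prime_dvd_power_iff)
      then have "int p ^ 2 dvd z\<^sup>2" by simp
      then have "int p ^ 2 dvd z\<^sup>2 - (z\<^sup>2 - (int p * u * x\<^sup>2 + int p * v * y\<^sup>2))"
        using d by (rule dvd_diff)
      then have "int p * int p dvd int p * (u * x\<^sup>2 + v * y\<^sup>2)"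
        by (simp add: power2_eq_square algebra_simps)
      then have 1: "int p dvd u * x\<^sup>2 + v * y\<^sup>2"
        using prime_gt_0_nat[OF p(1)] by simp
      \<comment> \<open>If \<open>y\<close> were a unit, multiplying the congruence by
        \<open>u\<close> would exhibit \<open>- (u * v)\<close> times a unit square as the square of
        \<open>u * x\<close>.\<close>
      have py: "int p dvd y"
      proof (rule ccontr)
        assume ny: "\<not> int p dvd y"
        then have y1: "Legendre y (int p) * Legendre y (int p) = 1"
          using Legendre_cases by fastforce
        have n': "\<not> int p dvd - (u * v) * (y * y)"
          using not_dvd_prime_mult[OF p(1)] ny n by blast
        have "(u * x)\<^sup>2 - - (u * v) * (y * y) = (u * x\<^sup>2 + v * y\<^sup>2) * u"
          by (simp add: algebra_simps power2_eq_square)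
        then have "int p dvd (u * x)\<^sup>2 - - (u * v) * (y * y)"
          using 1 by simp
        then have "Legendre (- (u * v) * (y * y)) (int p) = 1"
          using Legendre_eq_1_iff[OF n'] by blast
        then show False
          using False y1 Legendre_mult[OF p, of "- (u * v)" "y * y"] Legendre_mult[OF p, of y y] by simp
      qed
      then have "int p dvd (u * x\<^sup>2 + v * y\<^sup>2) - v * y\<^sup>2"
        by (intro dvd_diff 1) (simp add: power2_eq_square)
      then have "int p dvd x"
        using pp uv(1) by (simp add: prime_dvd_mult_iff prime_dvd_power_iff)
      then show False
        using xyz py pz by blast
    qed
    then show ?thesis
      using False Legendre_cases[OF n] hilbert_symbol_cases by metis
  qed
qed

lemma Legendre_power_mod_2:
  assumes "\<not> int p dvd u"
  shows "Legendre u (int p) ^ k = Legendre u (int p) ^ (k mod 2)"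
  using Legendre_cases[OF assms] by (auto simp: minus_one_power_iff even_iff_mod_2_eq_zero)

text \<open>Even powers of \<open>p\<close> are squares, so only the parities of the two valuations
  matter on either side. The four parity combinations are the cases evaluated above.\<close>

lemma hilbert_symbol_eq_tame_symbol:
  assumes p: "prime p" "odd p" and ab: "a \<noteq> 0" "b \<noteq> 0"
  shows "hilbert_symbol p (of_int a) (of_int b) = tame_symbol p a b"
proof -
  define i j u v where "i = multiplicity (int p) a" "j = multiplicity (int p) b"
    "u = unit_part p a" "v = unit_part p b"
  note defs = this
  have uv: "\<not> int p dvd u" "\<not> int p dvd v"
    using not_dvd_unit_part p ab by (auto simp: defs)
  have p0: "(of_int (int p) :: rat) \<noteq> 0"
    using prime_gt_0_nat[OF p(1)] by simp
  have split: "(of_int (int p ^ k * w) :: rat) = (of_int (int p) ^ (k div 2))\<^sup>2 * of_int (int p ^ (k mod 2) * w)" for k w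
    unfolding of_int_mult of_int_power power_mult[symmetric] mult.assoc[symmetric] power_add[symmetric]
    by simp
  define c d where "c = (of_int (int p) :: rat) ^ (i div 2)" "d = (of_int (int p) :: rat) ^ (j div 2)"
  note cd = this
  have a: "of_int a = c\<^sup>2 * of_int (int p ^ (i mod 2) * u)"
    using split[of i u] unit_part_decompose[of a p] by (simp add: defs cd)
  have b: "of_int b = d\<^sup>2 * of_int (int p ^ (j mod 2) * v)"
    using split[of j v] unit_part_decompose[of b p] by (simp add: defs cd)
  have "c \<noteq> 0" "d \<noteq> 0"
    using p0 by (auto simp: cd)
  then have "hilbert_symbol p (of_int a) (of_int b) =
      hilbert_symbol p (of_int (int p ^ (i mod 2) * u)) (of_int (int p ^ (j mod 2) * v))"
    unfolding a b
    by (rule trans[OF hilbert_symbol_mult_square_left[OF p(1)] hilbert_symbol_mult_square_right[OF p(1)]])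
  also have "\<dots> = Legendre (- 1) (int p) ^ ((i mod 2) * (j mod 2)) *
      Legendre u (int p) ^ (j mod 2) * Legendre v (int p) ^ (i mod 2)"
  proof -
    consider "i mod 2 = 0" "j mod 2 = 0" | "i mod 2 = 0" "j mod 2 = 1"
      | "i mod 2 = 1" "j mod 2 = 0" | "i mod 2 = 1" "j mod 2 = 1"
      by linarith
    then show ?thesis
    proof cases
      case 1
      then show ?thesis using hilbert_symbol_units[OF p uv] by simp
    next
      case 2
      then show ?thesis using hilbert_symbol_unit_prime[OF p uv] by simp
    next
      case 3
      then show ?thesis
        using hilbert_symbol_unit_prime[OF p uv(2,1)] hilbert_symbol_commute[OF p(1)] by simp
    next
      case 4
      then show ?thesis
        using hilbert_symbol_prime_prime[OF p uv] Legendre_mult[OF p, of "- 1" "u * v"] Legendre_mult[OF p, of u v]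
        by simp
    qed
  qed
  also have "\<dots> = tame_symbol p a b"
  proof -
    have "\<not> int p dvd - 1"
      using prime_gt_1_nat[OF p(1)] by simp
    from Legendre_power_mod_2[OF this, of "i * j"] Legendre_power_mod_2[OF this, of "(i mod 2) * (j mod 2)"]
    show ?thesis
      unfolding tame_symbol_def
      using Legendre_power_mod_2[OF uv(1), of j] Legendre_power_mod_2[OF uv(2), of i]
      by (simp add: defs mod_mult_eq)
  qed
  finally show ?thesis .
qed

lemma tame_symbol_integral_point:
  fixes a b x y z :: int
  assumes "prime p" "odd p" "a \<noteq> 0" "b \<noteq> 0" "(x, y, z) \<noteq> (0, 0, 0)" "z\<^sup>2 = a * x\<^sup>2 + b * y\<^sup>2"
  shows "tame_symbol p a b = 1"
proof -
  have "(of_int z)\<^sup>2 = of_int a * (of_int x)\<^sup>2 + of_int b * (of_int y :: rat)\<^sup>2"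
    using assms(6) by (metis of_int_add of_int_mult of_int_power)
  then have "hilbert_symbol p (of_int a) (of_int b) = 1"
    using assms(1,5) by (intro hilbert_symbol_rational_point[of p "of_int x" "of_int y" "of_int z"]) auto
  then show ?thesis
    using hilbert_symbol_eq_tame_symbol assms by simp
qed

section \<open>Legendre's theorem\<close>

definition conic_solvable :: "int \<Rightarrow> int \<Rightarrow> bool" where
  "conic_solvable a b \<longleftrightarrow> (\<exists>x y z. (x, y, z) \<noteq> (0, 0, 0) \<and> z\<^sup>2 = a * x\<^sup>2 + b * y\<^sup>2)"

lemma conic_solvableI:
  "z\<^sup>2 = a * x\<^sup>2 + b * y\<^sup>2 \<Longrightarrow> x \<noteq> 0 \<or> y \<noteq> 0 \<Longrightarrow> conic_solvable a b"
  unfolding conic_solvable_def by (intro exI[of _ x] exI[of _ y] exI[of _ z]) auto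

lemma conic_solvableE:
  assumes "conic_solvable a b"
  obtains x y z where "z\<^sup>2 = a * x\<^sup>2 + b * y\<^sup>2" "x \<noteq> 0 \<or> y \<noteq> 0"
proof -
  obtain x y z where xyz: "(x, y, z) \<noteq> (0, 0, 0)" "z\<^sup>2 = a * x\<^sup>2 + b * y\<^sup>2"
    using assms unfolding conic_solvable_def by blast
  then have "x \<noteq> 0 \<or> y \<noteq> 0" by auto
  then show ?thesis using that xyz(2) by blast
qed

lemma conic_solvable_commute: "conic_solvable a b \<longleftrightarrow> conic_solvable b a"
  by (metis add.commute conic_solvableE conic_solvableI)

lemma conic_solvable_square_left:
  assumes "conic_solvable a b" "c \<noteq> 0"
  shows "conic_solvable (c\<^sup>2 * a) b"
proof -
  obtain x y z where xyz: "z\<^sup>2 = a * x\<^sup>2 + b * y\<^sup>2" "x \<noteq> 0 \<or> y \<noteq> 0"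
    using assms(1) by (rule conic_solvableE)
  have "(c * z)\<^sup>2 = c\<^sup>2 * (a * x\<^sup>2 + b * y\<^sup>2)"
    using xyz(1) by (simp add: power_mult_distrib)
  then have "(c * z)\<^sup>2 = (c\<^sup>2 * a) * x\<^sup>2 + b * (c * y)\<^sup>2"
    by (simp add: algebra_simps)
  then show ?thesis
    by (rule conic_solvableI) (use xyz(2) assms(2) in auto)
qed

lemma conic_solvable_imp_tame_symbol:
  assumes "prime p" "odd p" "a \<noteq> 0" "b \<noteq> 0" "conic_solvable a b"
  shows "tame_symbol p a b = 1"
  using assms(5) unfolding conic_solvable_def
  by (elim exE conjE) (rule tame_symbol_integral_point[OF assms(1-4)])

section \<open>Square roots modulo a squarefree integer\<close>

lemma sqrt_mod_squarefree:
  fixes a b :: int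
  assumes "b \<noteq> 0" "squarefree b" "\<And>q. prime q \<Longrightarrow> q dvd b \<Longrightarrow> \<exists>w. q dvd w\<^sup>2 - a"
  shows "\<exists>w. b dvd w\<^sup>2 - a"
  using assms
proof (induction b rule: prime_divisors_induct)
  case (factor q b)
  \<comment> \<open>Squarefreeness makes the prime that is split off coprime to the rest, so the
    Chinese remainder theorem can glue the two roots.\<close>
  have nd: "\<not> q dvd b"
  proof
    assume "q dvd b"
    then have "q\<^sup>2 dvd q * b"
      by (simp add: power2_eq_square)
    then have "is_unit q"
      using factor.prems(2) unfolding squarefree_def by blast
    then show False using factor.hyps by (simp add: not_prime_unit)
  qed
  then have cop: "coprime q b"
    using factor.hyps by (simp add: prime_imp_coprime)
  have sf: "squarefree b"
    using factor.prems(2) by (rule squarefree_mono[rotated]) simp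
  obtain v where v: "b dvd v\<^sup>2 - a"
    using factor.IH[OF _ sf] factor.prems by auto
  obtain u where u: "q dvd u\<^sup>2 - a"
    using factor.prems(3)[of q] factor.hyps by auto
  obtain w where w: "[w = u] (mod q)" "[w = v] (mod b)"
    using binary_chinese_remainder_int[OF cop] by blast
  have "[w\<^sup>2 = a] (mod q)" "[w\<^sup>2 = a] (mod b)"
    using cong_trans[OF cong_pow[OF w(1), of 2], of a] cong_trans[OF cong_pow[OF w(2), of 2], of a] u v
    by (simp_all add: cong_iff_dvd_diff)
  then have "q * b dvd w\<^sup>2 - a"
    using cop by (simp add: cong_iff_dvd_diff divides_mult)
  then show ?case by blast
next
  case (unit b)
  then show ?case using unit_imp_dvd by blast
qed simp

text \<open>The residue is taken of least absolute value; the factor 2 gained here is what makes the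
  cofactor in the descent smaller than \<open>b\<close>.\<close>

lemma sqrt_mod_small:
  fixes a b :: int
  assumes "b \<noteq> 0" "\<exists>w. b dvd w\<^sup>2 - a"
  obtains w where "b dvd w\<^sup>2 - a" "2 * \<bar>w\<bar> \<le> \<bar>b\<bar>"
proof -
  obtain v where v: "b dvd v\<^sup>2 - a"
    using assms(2) by blast
  define r where "r = v mod \<bar>b\<bar>"
  have r: "0 \<le> r" "r < \<bar>b\<bar>" "b dvd r - v"
    using assms(1) mod_eq_dvd_iff[of r "\<bar>b\<bar>" v] by (auto simp: r_def)
  define w where "w = (if 2 * r \<le> \<bar>b\<bar> then r else r - \<bar>b\<bar>)"
  have "b dvd w - v"
    using r(3) dvd_diff[OF r(3), of "\<bar>b\<bar>"] by (auto simp: w_def algebra_simps)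
  then have "b dvd (w - v) * (w + v) + (v\<^sup>2 - a)"
    using v by (intro dvd_add dvd_mult2)
  then have "b dvd w\<^sup>2 - a"
    by (simp add: algebra_simps power2_eq_square)
  moreover have "2 * \<bar>w\<bar> \<le> \<bar>b\<bar>"
    using r by (auto simp: w_def)
  ultimately show ?thesis using that by blast
qed

text \<open>At an odd prime dividing \<open>b\<close> but not \<open>a\<close> the valuations are 1
  and 0, so the symbol collapses to the Legendre symbol of \<open>a\<close>. At a prime dividing
  \<open>a\<close> the root is 0. At 2 the root is \<open>a\<close> itself, whence no condition
  there.\<close>

lemma sqrt_mod_of_tame_symbol:
  fixes a b :: int
  assumes ab: "a \<noteq> 0" "b \<noteq> 0" and sf: "squarefree b"
    and tame: "\<And>p. prime p \<Longrightarrow> odd p \<Longrightarrow> tame_symbol p a b = 1"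
  shows "\<exists>w. b dvd w\<^sup>2 - a"
proof (rule sqrt_mod_squarefree[OF ab(2) sf])
  fix q :: int assume q: "prime q" "q dvd b"
  obtain p where qp: "q = int p"
    using prime_ge_0_int[OF q(1)] zero_le_imp_eq_int by blast
  then have p: "prime p" using q(1) by simp
  show "\<exists>w. q dvd w\<^sup>2 - a"
  proof (cases "q dvd a \<or> even p")
    case True
    then show ?thesis
    proof
      assume "q dvd a"
      then show ?thesis by (intro exI[of _ 0]) simp
    next
      assume "even p"
      then have "q = 2"
        using p qp by (metis of_nat_numeral primes_dvd_imp_eq two_is_prime_nat)
      then show ?thesis by (intro exI[of _ a]) simp
    qed
  next
    case False
    have nu: "\<not> is_unit (int p)"
      using prime_gt_1_nat[OF p] by simp
    have "\<not> int p ^ 2 dvd b"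
      using sf nu unfolding squarefree_def by blast
    then have "multiplicity (int p) b < 2"
      using power_dvd_iff_le_multiplicity[OF ab(2) nu, of 2] by simp
    moreover have "multiplicity (int p) b \<ge> 1"
      using power_dvd_iff_le_multiplicity[OF ab(2) nu, of 1] q(2) qp by simp
    ultimately have mb: "multiplicity (int p) b = 1" by simp
    have ma: "multiplicity (int p) a = 0"
      using False qp by (simp add: not_dvd_imp_multiplicity_0)
    have "tame_symbol p a b = Legendre a (int p)"
      unfolding tame_symbol_def ma mb by (simp add: unit_part_def ma)
    then have "Legendre a (int p) = 1"
      using tame[OF p] False by simp
    then show ?thesis
      using Legendre_eq_1_iff False qp by auto
  qed
qed

lemma not_squarefree_intE:
  fixes a :: int
  assumes "a \<noteq> 0" "\<not> squarefree a"
  obtains c a' where "a = c\<^sup>2 * a'" "c \<noteq> 0" "a' \<noteq> 0" "\<bar>a'\<bar> < \<bar>a\<bar>"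
proof -
  obtain c where "c\<^sup>2 dvd a" and c: "\<not> is_unit c"
    using assms(2) unfolding squarefree_def by blast
  then obtain a' where a: "a = c\<^sup>2 * a'" by auto
  then have "c \<noteq> 0" "a' \<noteq> 0"
    using assms(1) by auto
  moreover have "1 < \<bar>c\<bar>"
    using c calculation(1) by (simp add: zdvd1_eq)
  then have "\<bar>a'\<bar> < \<bar>a\<bar>"
    using calculation(2) one_less_power[of "\<bar>c\<bar>" 2] by (simp add: a abs_mult)
  ultimately show ?thesis using that a by blast
qed

text \<open>
  \<open>b c\<close> is a norm from \<open>\<rat>(\<surd>a)\<close>, hence \<open>b\<close> is one up to squares iff \<open>c\<close> is.
\<close>

lemma conic_solvable_descent:
  fixes a b c w :: int
  assumes bc: "w\<^sup>2 - a = b * c" and c: "c \<noteq> 0" and sol: "conic_solvable a c"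
  shows "conic_solvable a b"
proof -
  obtain x y z where xyz: "z\<^sup>2 = a * x\<^sup>2 + c * y\<^sup>2" "x \<noteq> 0 \<or> y \<noteq> 0"
    using sol by (rule conic_solvableE)
  show ?thesis
  proof (cases "y = 0")
    case True
    then have "z\<^sup>2 = a * x\<^sup>2 + b * 0\<^sup>2" using xyz by simp
    then show ?thesis
      by (rule conic_solvableI) (use True xyz in auto)
  next
    case False
    \<comment> \<open>Multiplicativity of the norm, applied to the product of
      \<open>w + sqrt a\<close> and \<open>z + x * sqrt a\<close>.\<close>
    have "(w * z + a * x)\<^sup>2 - a * (w * x + z)\<^sup>2 = (w\<^sup>2 - a) * (z\<^sup>2 - a * x\<^sup>2)"
      by (simp add: algebra_simps power2_eq_square)
    also have "\<dots> = b * (c * y)\<^sup>2"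
      unfolding bc using xyz(1) by (simp add: power2_eq_square)
    finally have "(w * z + a * x)\<^sup>2 = a * (w * x + z)\<^sup>2 + b * (c * y)\<^sup>2"
      by simp
    then show ?thesis
      by (rule conic_solvableI) (use False c in auto)
  qed
qed

text \<open>Legendre's descent on the sum of the absolute values. Square factors of the larger
  coefficient \<open>b\<close> are stripped; a squarefree \<open>b\<close> is traded for the
  cofactor \<open>c\<close> in \<open>w^2 - a = b * c\<close>. Both the symbols and the sign
  condition must survive the trade.\<close>

theorem legendre_conic:
  fixes a b :: int
  assumes "a \<noteq> 0" "b \<noteq> 0" "a > 0 \<or> b > 0"
    and "\<And>p. prime p \<Longrightarrow> odd p \<Longrightarrow> tame_symbol p a b = 1"
  shows "conic_solvable a b"
  using assms
proof (induction "nat (\<bar>a\<bar> + \<bar>b\<bar>)" arbitrary: a b rule: less_induct)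
  case less
  \<comment> \<open>The step is stated for fresh \<open>a\<close>, \<open>b\<close> with its own
    induction hypothesis, so that it also serves the pair in swapped order.\<close>
  have sq: "conic_solvable a b"
    if ab: "a \<noteq> 0" "b \<noteq> 0" "a > 0 \<or> b > 0"
      and tame: "\<And>p. prime p \<Longrightarrow> odd p \<Longrightarrow> tame_symbol p a b = 1"
      and IH: "\<And>a' b'. \<bar>a'\<bar> + \<bar>b'\<bar> < \<bar>a\<bar> + \<bar>b\<bar> \<Longrightarrow> a' \<noteq> 0 \<Longrightarrow> b' \<noteq> 0 \<Longrightarrow> a' > 0 \<or> b' > 0 \<Longrightarrow>
        (\<And>p. prime p \<Longrightarrow> odd p \<Longrightarrow> tame_symbol p a' b' = 1) \<Longrightarrow> conic_solvable a' b'"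
      and le: "\<bar>a\<bar> \<le> \<bar>b\<bar>"
    for a b :: int
  proof (cases "squarefree b")
    case False
    obtain c b' where b': "b = c\<^sup>2 * b'" "c \<noteq> 0" "b' \<noteq> 0" "\<bar>b'\<bar> < \<bar>b\<bar>"
      using not_squarefree_intE[OF ab(2) False] .
    have "tame_symbol p b' a = 1" if "prime p" "odd p" for p
      using tame[OF that] tame_symbol_square_left[OF that b'(2,3) ab(1)]
      unfolding b'(1) by (simp add: tame_symbol_commute)
    moreover have "b' > 0 \<or> a > 0"
      using ab(3) b'(1) by (auto simp: zero_less_mult_iff)
    ultimately have "conic_solvable b' a"
      using ab b' by (intro IH) auto
    then show ?thesis
      unfolding b'(1) conic_solvable_commute[of a] by (rule conic_solvable_square_left) fact
  next
    case sf: True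
    show ?thesis
    proof (cases "\<bar>b\<bar> = 1")
      case True
      \<comment> \<open>Both coefficients are now 1 or -1, and the sign hypothesis excludes two
        negative ones.\<close>
      then have "a = 1 \<or> b = 1"
        using ab le by linarith
      then show ?thesis
        using conic_solvableI[of 1 a 1 b 0] conic_solvableI[of 1 a 0 b 1] by auto
    next
      case False
      then have b2: "\<bar>b\<bar> \<ge> 2" using ab by linarith
      obtain w where w: "b dvd w\<^sup>2 - a" "2 * \<bar>w\<bar> \<le> \<bar>b\<bar>"
        using sqrt_mod_small[OF ab(2) sqrt_mod_of_tame_symbol[OF ab(1,2) sf tame]] by blast
      obtain c where c: "w\<^sup>2 - a = b * c" using w(1) by auto
      show ?thesis
      proof (cases "c = 0")
        case True
        then have "w\<^sup>2 = a * 1\<^sup>2 + b * 0\<^sup>2" using c by simp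
        then show ?thesis by (rule conic_solvableI) simp
      next
        case c0: False
        \<comment> \<open>The estimate is
          \<open>|b| |c| \<le> w^2 + |a| \<le> b^2 / 4 + |b|\<close>, so
          \<open>|c| \<le> |b| / 4 + 1\<close>, which is below \<open>|b|\<close> once
          \<open>|b| \<ge> 2\<close>.\<close>
        have "(2 * \<bar>w\<bar>) * (2 * \<bar>w\<bar>) \<le> \<bar>b\<bar> * \<bar>b\<bar>"
          using w(2) by (intro mult_mono) auto
        then have "4 * w\<^sup>2 \<le> \<bar>b\<bar> * \<bar>b\<bar>"
          by (simp add: power2_eq_square)
        moreover have "\<bar>b\<bar> * \<bar>c\<bar> \<le> w\<^sup>2 + \<bar>a\<bar>"
          unfolding abs_mult[symmetric] c[symmetric] using abs_triangle_ineq4[of "w\<^sup>2" a] by simp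
        ultimately have "\<bar>b\<bar> * (4 * \<bar>c\<bar>) \<le> \<bar>b\<bar> * (\<bar>b\<bar> + 4)"
          using le by (simp add: algebra_simps)
        then have "4 * \<bar>c\<bar> \<le> \<bar>b\<bar> + 4"
          using ab(2) by (subst (asm) mult_le_cancel_left_pos) auto
        then have cb: "\<bar>c\<bar> < \<bar>b\<bar>"
          using b2 by linarith
        have "w\<^sup>2 = a * 1\<^sup>2 + (b * c) * 1\<^sup>2"
          by (simp flip: c)
        \<comment> \<open>The equation defining \<open>c\<close> is itself a point on the conic with
          coefficients \<open>a\<close> and \<open>b * c\<close>. Its symbol is therefore 1 at every
          odd prime, and multiplicativity passes the condition from \<open>b\<close> to
          \<open>c\<close>.\<close>
        then have "conic_solvable a (b * c)"
          by (rule conic_solvableI) simp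
        then have "tame_symbol p a c = 1" if "prime p" "odd p" for p
          using conic_solvable_imp_tame_symbol[OF that ab(1), of "b * c"] ab c0 tame[OF that]
            tame_symbol_mult_right[OF that ab(2) c0, of a] by simp
        \<comment> \<open>Solvability over the reals persists: for negative \<open>a\<close> the
          product \<open>b * c = w^2 - a\<close> is positive, so \<open>c\<close> has the sign of
          \<open>b\<close>.\<close>
        moreover have "a > 0 \<or> c > 0"
        proof (rule disjCI)
          assume "\<not> c > 0"
          show "a > 0"
          proof (rule ccontr)
            assume a: "\<not> a > 0"
            then have "b > 0" using ab by simp
            then have "b * c < 0"
              using \<open>\<not> c > 0\<close> c0 by (simp add: mult_pos_neg)
            moreover have "w\<^sup>2 - a \<ge> 0"
              using a zero_le_power2[of w] by linarith
            ultimately show False using c by simp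
          qed
        qed
        ultimately have "conic_solvable a c"
          using cb ab c0 by (intro IH) auto
        then show ?thesis
          using conic_solvable_descent[OF c c0] by blast
      qed
    qed
  qed
  have IH: "conic_solvable a' b'"
    if "\<bar>a'\<bar> + \<bar>b'\<bar> < \<bar>a\<bar> + \<bar>b\<bar>" "a' \<noteq> 0" "b' \<noteq> 0" "a' > 0 \<or> b' > 0"
      "\<And>p. prime p \<Longrightarrow> odd p \<Longrightarrow> tame_symbol p a' b' = 1" for a' b'
    by (rule less.hyps) (use that in simp_all)
  show ?case
  proof (cases "\<bar>a\<bar> \<le> \<bar>b\<bar>")
    case True
    show ?thesis
      by (rule sq[OF less.prems IH True])
  next
    case False
    have "conic_solvable b a"
    proof (rule sq)
      show "b \<noteq> 0" "a \<noteq> 0" "b > 0 \<or> a > 0" "\<bar>b\<bar> \<le> \<bar>a\<bar>"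
        using less.prems False by auto
      show "tame_symbol p b a = 1" if "prime p" "odd p" for p
        using less.prems(4)[OF that] by (simp add: tame_symbol_commute)
      show "conic_solvable a' b'"
        if "\<bar>a'\<bar> + \<bar>b'\<bar> < \<bar>b\<bar> + \<bar>a\<bar>" "a' \<noteq> 0" "b' \<noteq> 0" "a' > 0 \<or> b' > 0"
          "\<And>p. prime p \<Longrightarrow> odd p \<Longrightarrow> tame_symbol p a' b' = 1" for a' b'
        using that(1) by (intro IH that(2-)) simp_all
    qed
    then show ?thesis by (simp add: conic_solvable_commute)
  qed
qed

section \<open>Angles and conics\<close>

lemma tame_symbol_self:
  assumes p: "prime p" "odd p" and a: "a \<noteq> 0"
  shows "tame_symbol p a a = tame_symbol p a (- 1)"
proof -
  have "conic_solvable a (- a)"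
    by (rule conic_solvableI[of 0 _ 1 _ 1]) auto
  then have "tame_symbol p a (- 1) * tame_symbol p a a = 1"
    using conic_solvable_imp_tame_symbol[OF p a, of "- a"] tame_symbol_mult_right[OF p, of "- 1" a a] a by simp
  then show ?thesis
    using tame_symbol_cases[OF p(1) a a] by auto
qed

lemma tame_symbol_conic_of_three_squares:
  fixes i j k T :: int
  assumes p: "prime p" "odd p" and n: "n = m + k\<^sup>2" and m: "m = i\<^sup>2 + j\<^sup>2"
    and nz: "n \<noteq> 0" "m \<noteq> 0" "T \<noteq> 0"
  shows "tame_symbol p (- n) (m * T) = tame_symbol p n n * tame_symbol p n T * tame_symbol p T T"
proof -
  have neg: "tame_symbol p (- n) x = tame_symbol p (- 1) x * tame_symbol p n x" for x
    using tame_symbol_mult_left[OF p, of "- 1" n x] nz by simp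
  have "i\<^sup>2 = - 1 * j\<^sup>2 + m * 1\<^sup>2"
    by (simp add: m)
  then have "conic_solvable (- 1) m"
    by (rule conic_solvableI) simp
  then have m1: "tame_symbol p (- 1) m = 1"
    using nz by (intro conic_solvable_imp_tame_symbol p) auto
  have "k\<^sup>2 = n * 1\<^sup>2 + - m * 1\<^sup>2"
    by (simp add: n)
  then have "conic_solvable n (- m)"
    by (rule conic_solvableI) simp
  then have "tame_symbol p n (- 1 * m) = 1"
    using nz by (intro conic_solvable_imp_tame_symbol p) auto
  \<comment> \<open>All values are signs, so this says that the symbol of \<open>n\<close>,
    \<open>m\<close> equals that of \<open>n\<close>, \<open>- 1\<close>, which
    \<open>tame_symbol_self\<close> turns into that of \<open>n\<close>, \<open>n\<close>.\<close>
  then have "tame_symbol p n (- 1) * tame_symbol p n m = 1"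
    using nz tame_symbol_mult_right[OF p, of "- 1" m n] by simp
  then have nm: "tame_symbol p n m = tame_symbol p n n"
    using tame_symbol_cases[OF p(1) nz(1,2)] tame_symbol_self[OF p nz(1)] by auto
  have "tame_symbol p (- n) (m * T) = tame_symbol p (- n) m * tame_symbol p (- n) T"
    using nz by (intro tame_symbol_mult_right p)
  then show ?thesis
    using tame_symbol_self[OF p nz(3)] tame_symbol_commute[of p T "- 1"] by (simp add: neg m1 nm)
qed

text \<open>
  Coordinates of \<open>b\<close> in the orthogonal frame \<open>a\<close>, \<open>(-a\<^sub>2, a\<^sub>1, 0)\<close>, \<open>(-a\<^sub>1 a\<^sub>3, -a\<^sub>2 a\<^sub>3, a\<^sub>1\<^sup>2 + a\<^sub>2\<^sup>2)\<close>,
  whose vectors have squared lengths \<open>n\<close>, \<open>m\<close>, \<open>m n\<close>.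
\<close>

lemma same_angle_iff_conic_solvable:
  fixes a1 a2 a3 c T :: int
  assumes n: "n = a1\<^sup>2 + a2\<^sup>2 + a3\<^sup>2" and m: "m = a1\<^sup>2 + a2\<^sup>2" "m \<noteq> 0" and c: "c \<noteq> 0" and T: "T > 0"
  shows "(\<exists>b1 b2 b3. (a1 * b1 + a2 * b2 + a3 * b3) * c > 0 \<and>
            (a1 * b1 + a2 * b2 + a3 * b3)\<^sup>2 * (c\<^sup>2 + T) = c\<^sup>2 * (n * (b1\<^sup>2 + b2\<^sup>2 + b3\<^sup>2)))
    \<longleftrightarrow> conic_solvable (- n) (m * T)"
    (is "?L \<longleftrightarrow> ?R")
proof
  assume ?L
  then obtain b1 b2 b3 where pos: "(a1 * b1 + a2 * b2 + a3 * b3) * c > 0"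
    and eq: "(a1 * b1 + a2 * b2 + a3 * b3)\<^sup>2 * (c\<^sup>2 + T) = c\<^sup>2 * (n * (b1\<^sup>2 + b2\<^sup>2 + b3\<^sup>2))"
    by blast
  define d x y where "d = a1 * b1 + a2 * b2 + a3 * b3" "x = a1 * b2 - a2 * b1"
    "y = m * b3 - a3 * (a1 * b1 + a2 * b2)"
  note defs = this
  \<comment> \<open>Pythagoras in the orthogonal frame: \<open>d\<close>, \<open>x\<close>,
    \<open>y\<close> are the scalar products of \<open>b\<close> with the frame vectors, and the
    identity is cleared of the squared lengths \<open>n\<close>, \<open>m\<close>,
    \<open>m n\<close>.\<close>
  have frame: "m * (n * (b1\<^sup>2 + b2\<^sup>2 + b3\<^sup>2) - d\<^sup>2) = n * x\<^sup>2 + y\<^sup>2"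
    unfolding defs n m by (simp add: algebra_simps power2_eq_square)
  have "d\<^sup>2 * T = c\<^sup>2 * (n * (b1\<^sup>2 + b2\<^sup>2 + b3\<^sup>2) - d\<^sup>2)"
    using eq by (simp add: defs algebra_simps)
  then have "(m * T) * d\<^sup>2 = c\<^sup>2 * (m * (n * (b1\<^sup>2 + b2\<^sup>2 + b3\<^sup>2) - d\<^sup>2))"
    by (simp add: mult_ac)
  then have "(c * y)\<^sup>2 = - n * (c * x)\<^sup>2 + (m * T) * d\<^sup>2"
    unfolding frame by (simp add: algebra_simps power_mult_distrib)
  moreover have "d \<noteq> 0"
    using pos by (auto simp: defs)
  ultimately show ?R
    by (intro conic_solvableI) auto
next
  assume ?R
  then obtain x y' z where sol': "z\<^sup>2 = - n * x\<^sup>2 + (m * T) * y'\<^sup>2" and nz: "x \<noteq> 0 \<or> y' \<noteq> 0"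
    by (rule conic_solvableE)
  have "m > 0"
    using m by (simp add: order_le_neq_trans)
  then have n0: "n > 0"
    using m n by (simp add: add_pos_nonneg)
  \<comment> \<open>A point with \<open>y' = 0\<close> would give a vector orthogonal to
    \<open>a\<close>; it is excluded because \<open>- n\<close> is negative.\<close>
  have "y' \<noteq> 0"
  proof
    assume "y' = 0"
    then have "n * x\<^sup>2 > 0" "z\<^sup>2 = - (n * x\<^sup>2)"
      using nz n0 sol' by auto
    then show False
      by (metis neg_less_0_iff_less not_less zero_le_power2)
  qed
  \<comment> \<open>The conic does not see the sign of \<open>y'\<close>. The positive choice makes
    the scalar product with \<open>a\<close> have the sign of \<open>c\<close>, selecting the angle
    and not its supplement.\<close>
  define y where "y = \<bar>y'\<bar>"
  have y: "y > 0" and sol: "z\<^sup>2 + n * x\<^sup>2 = m * T * y\<^sup>2"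
    using \<open>y' \<noteq> 0\<close> sol' by (simp_all add: y_def)
  \<comment> \<open>The frame vectors with coefficients \<open>m * y * c\<close>,
    \<open>n * x\<close> and \<open>z\<close>. The part along \<open>a\<close> has squared length
    \<open>n m^2 y^2 c^2\<close>; by the conic equation the orthogonal part has
    \<open>n m^2 y^2 T\<close>. Their ratio is \<open>T / c^2\<close>, the prescribed tangent
    squared.\<close>
  define b1 b2 b3 where "b1 = m * y * c * a1 - n * x * a2 - z * a1 * a3"
    "b2 = m * y * c * a2 + n * x * a1 - z * a2 * a3" "b3 = m * y * c * a3 + z * m"
  note b = this
  have d: "a1 * b1 + a2 * b2 + a3 * b3 = n * m * y * c"
    unfolding b n m by (simp add: algebra_simps power2_eq_square)
  have B: "b1\<^sup>2 + b2\<^sup>2 + b3\<^sup>2 = n * (m * y * c)\<^sup>2 + n * m * (z\<^sup>2 + n * x\<^sup>2)"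
    unfolding b n m by (simp add: algebra_simps power2_eq_square)
  have "(n * m * y * c) * c = n * m * y * c\<^sup>2"
    by (simp add: power2_eq_square)
  also have "\<dots> > 0"
    using n0 \<open>m > 0\<close> y c by simp
  finally have "(a1 * b1 + a2 * b2 + a3 * b3) * c > 0"
    by (simp only: d)
  moreover have "(a1 * b1 + a2 * b2 + a3 * b3)\<^sup>2 * (c\<^sup>2 + T) = c\<^sup>2 * (n * (b1\<^sup>2 + b2\<^sup>2 + b3\<^sup>2))"
    unfolding d B sol by (simp add: algebra_simps power2_eq_square)
  ultimately show ?L by blast
qed

lemma same_angle_iff_tame_symbol_of_coords:
  fixes a1 a2 a3 c T :: int
  assumes n: "n = a1\<^sup>2 + a2\<^sup>2 + a3\<^sup>2" "a1\<^sup>2 + a2\<^sup>2 \<noteq> 0" and c: "c \<noteq> 0" and T: "T > 0"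
  shows "(\<exists>b1 b2 b3. (a1 * b1 + a2 * b2 + a3 * b3) * c > 0 \<and>
            (a1 * b1 + a2 * b2 + a3 * b3)\<^sup>2 * (c\<^sup>2 + T) = c\<^sup>2 * (n * (b1\<^sup>2 + b2\<^sup>2 + b3\<^sup>2)))
    \<longleftrightarrow> (\<forall>p. prime p \<and> odd p \<longrightarrow> tame_symbol p n n * tame_symbol p n T * tame_symbol p T T = 1)"
proof -
  define m where "m = a1\<^sup>2 + a2\<^sup>2"
  have m: "m > 0"
    using n(2) by (simp add: m_def order_le_neq_trans)
  have nm: "n = m + a3\<^sup>2"
    by (simp add: n m_def)
  have nz: "n \<noteq> 0" "m \<noteq> 0" "T \<noteq> 0" "m * T > 0"
    using m T by (simp_all add: nm add_pos_nonneg less_imp_neq[THEN not_sym])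
  \<comment> \<open>The sign condition of Legendre's theorem is supplied by
    \<open>m * T > 0\<close>, the other coefficient being negative.\<close>
  have "conic_solvable (- n) (m * T) \<longleftrightarrow> (\<forall>p. prime p \<and> odd p \<longrightarrow> tame_symbol p (- n) (m * T) = 1)"
    using nz conic_solvable_imp_tame_symbol[of _ "- n" "m * T"] legendre_conic[of "- n" "m * T"] by auto
  also have "\<dots> \<longleftrightarrow> (\<forall>p. prime p \<and> odd p \<longrightarrow>
      tame_symbol p n n * tame_symbol p n T * tame_symbol p T T = 1)"
    using tame_symbol_conic_of_three_squares[OF _ _ nm m_def nz(1-3)] by auto
  finally show ?thesis
    using same_angle_iff_conic_solvable[OF n(1) m_def nz(2) c T] by blast
qed

lemma same_angle_iff_tame_symbol:
  fixes a1 a2 a3 c T :: int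
  assumes n: "n = a1\<^sup>2 + a2\<^sup>2 + a3\<^sup>2" "n \<noteq> 0" and c: "c \<noteq> 0" and T: "T > 0"
  shows "(\<exists>b1 b2 b3. (a1 * b1 + a2 * b2 + a3 * b3) * c > 0 \<and>
            (a1 * b1 + a2 * b2 + a3 * b3)\<^sup>2 * (c\<^sup>2 + T) = c\<^sup>2 * (n * (b1\<^sup>2 + b2\<^sup>2 + b3\<^sup>2)))
    \<longleftrightarrow> (\<forall>p. prime p \<and> odd p \<longrightarrow> tame_symbol p n n * tame_symbol p n T * tame_symbol p T T = 1)"
    (is "(\<exists>b1 b2 b3. ?P b1 b2 b3) \<longleftrightarrow> ?R")
proof (cases "a1\<^sup>2 + a2\<^sup>2 = 0")
  case False
  then show ?thesis
    using same_angle_iff_tame_symbol_of_coords[OF n(1) _ c T] by blast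
next
  case True
  \<comment> \<open>Now \<open>a3\<close> is nonzero, and shifting the coordinates of both vectors
    cyclically preserves the scalar products.\<close>
  then have n': "n = a3\<^sup>2 + a1\<^sup>2 + a2\<^sup>2" "a3\<^sup>2 + a1\<^sup>2 \<noteq> 0"
    using n by (auto simp: sum_power2_eq_zero_iff)
  have "(\<exists>b3 b1 b2. ?P b1 b2 b3) \<longleftrightarrow> ?R"
    using same_angle_iff_tame_symbol_of_coords[OF n' c T] by (simp add: add_ac)
  then show ?thesis by blast
qed

section \<open>Integer vectors and equality of angles\<close>

lemma integer_latticeE:
  assumes "a \<in> integer_lattice"
  obtains x y z :: int where "a = vector [of_int x, of_int y, of_int z]"
proof -
  have "a $ 1 \<in> \<int>" "a $ 2 \<in> \<int>" "a $ 3 \<in> \<int>"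
    using assms by (auto simp: integer_lattice_def)
  then obtain x y z where "a $ 1 = of_int x" "a $ 2 = of_int y" "a $ 3 = of_int z"
    by (auto elim!: Ints_cases)
  then have "a = vector [of_int x, of_int y, of_int z]"
    by (simp add: vec_eq_iff forall_3)
  then show ?thesis by (rule that)
qed

lemma vector_of_int_in_integer_lattice:
  "(vector [of_int x, of_int y, of_int z] :: real ^ 3) \<in> integer_lattice"
  by (simp add: integer_lattice_def forall_3)

lemma inner_vector_of_int:
  "(vector [of_int x, of_int y, of_int z] :: real ^ 3) \<bullet> vector [of_int u, of_int v, of_int w] =
    of_int (x * u + y * v + z * w)"
  by (simp add: inner_vec_def sum_3)

text \<open>For cosines, \<open>P\<close> and \<open>Q\<close> are products of norms and in general
  irrational. Squaring makes the equation one between integers, and the sign condition restores what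
  squaring loses.\<close>

lemma divide_eq_divide_iff_squares:
  fixes d c P Q :: real
  assumes "P > 0" "Q > 0" "c \<noteq> 0"
  shows "d / P = c / Q \<longleftrightarrow> d * c > 0 \<and> d\<^sup>2 * Q\<^sup>2 = c\<^sup>2 * P\<^sup>2"
proof
  assume "d / P = c / Q"
  then have *: "d = c * (P / Q)"
    using assms by (simp add: field_simps)
  have "d * c = c\<^sup>2 * (P / Q)"
    by (simp add: * power2_eq_square)
  also have "\<dots> > 0" using assms by simp
  finally show "d * c > 0 \<and> d\<^sup>2 * Q\<^sup>2 = c\<^sup>2 * P\<^sup>2"
    using assms by (simp add: * power_mult_distrib power_divide)
next
  assume *: "d * c > 0 \<and> d\<^sup>2 * Q\<^sup>2 = c\<^sup>2 * P\<^sup>2"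
  then have "(d * Q)\<^sup>2 = (c * P)\<^sup>2"
    by (simp add: power_mult_distrib)
  then consider "d * Q = c * P" | "d * Q = - (c * P)"
    using power2_eq_iff by blast
  then show "d / P = c / Q"
  proof cases
    case 2
    have "(d * c) * Q = (d * Q) * c"
      by simp
    also have "\<dots> = - (c\<^sup>2 * P)"
      unfolding 2 by (simp add: power2_eq_square)
    finally have "(d * c) * Q = - (c\<^sup>2 * P)" .
    moreover have "(d * c) * Q > 0" "c\<^sup>2 * P > 0"
      using * assms by simp_all
    ultimately show ?thesis by linarith
  qed (use assms in \<open>simp add: field_simps\<close>)
qed

lemma vec_angle_eq_iff:
  assumes "a \<noteq> 0" "b \<noteq> 0" "a' \<noteq> 0" "b' \<noteq> 0" "a' \<bullet> b' \<noteq> 0"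
  shows "vec_angle a b = vec_angle a' b' \<longleftrightarrow>
    (a \<bullet> b) * (a' \<bullet> b') > 0 \<and>
    (a \<bullet> b)\<^sup>2 * ((a' \<bullet> a') * (b' \<bullet> b')) = (a' \<bullet> b')\<^sup>2 * ((a \<bullet> a) * (b \<bullet> b))"
proof -
  have bound: "\<bar>(v \<bullet> w) / (norm v * norm w)\<bar> \<le> 1" if "v \<noteq> 0" "w \<noteq> 0" for v w :: "real ^ 3"
    using Cauchy_Schwarz_ineq2[of v w] that by (simp add: abs_mult field_simps)
  have "vec_angle a b = vec_angle a' b' \<longleftrightarrow>
      (a \<bullet> b) / (norm a * norm b) = (a' \<bullet> b') / (norm a' * norm b')"
    unfolding vec_angle_def using assms by (intro arccos_eq_iff conjI bound)
  also have "\<dots> \<longleftrightarrow> (a \<bullet> b) * (a' \<bullet> b') > 0 \<and>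
      (a \<bullet> b)\<^sup>2 * (norm a' * norm b')\<^sup>2 = (a' \<bullet> b')\<^sup>2 * (norm a * norm b)\<^sup>2"
    using assms by (intro divide_eq_divide_iff_squares) auto
  finally show ?thesis
    by (simp add: power_mult_distrib power2_norm_eq_inner)
qed

lemma rat_of_real_of_rat: "rat_of_real (of_rat q) = q"
  by (simp add: rat_of_real_def)

theorem lemma2p4:
  fixes a :: "real ^ 3" and \<theta> :: real
  assumes "a \<in> integer_lattice - {0}"
    and "\<theta> \<in> Theta3"
    and "\<theta> \<noteq> 0" and "\<theta> \<noteq> pi / 2" and "\<theta> \<noteq> pi"
  shows "\<theta> \<in> Theta3_at a \<longleftrightarrow>
    (\<forall>p::nat. prime p \<and> odd p \<longrightarrow>
      hilbert_symbol p (rat_of_real ((norm a)\<^sup>2)) (rat_of_real ((norm a)\<^sup>2)) *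
      hilbert_symbol p (rat_of_real ((norm a)\<^sup>2)) (rat_of_real ((tan \<theta>)\<^sup>2)) *
      hilbert_symbol p (rat_of_real ((tan \<theta>)\<^sup>2)) (rat_of_real ((tan \<theta>)\<^sup>2)) = 1)"
proof -
  obtain a' b' where ab': "a' \<in> integer_lattice" "a' \<noteq> 0" "b' \<in> integer_lattice" "b' \<noteq> 0"
    and \<theta>: "\<theta> = vec_angle a' b'"
    using assms(2) by (auto simp: Theta3_def)
  obtain a1 a2 a3 where a: "a = vector [of_int a1, of_int a2, of_int a3]"
    using assms(1) by (auto elim: integer_latticeE)
  define n where "n = a1\<^sup>2 + a2\<^sup>2 + a3\<^sup>2"
  have n: "a \<bullet> a = of_int n"
    unfolding a inner_vector_of_int by (simp add: n_def power2_eq_square)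
  have n0: "n \<noteq> 0"
    using n assms(1) by auto
  obtain c where c: "a' \<bullet> b' = of_int c"
    using integer_lattice_inner[OF ab'(1,3)] by (auto elim: Ints_cases)
  obtain N where N: "(a' \<bullet> a') * (b' \<bullet> b') = of_int N"
    using integer_lattice_inner[OF ab'(1,1)] integer_lattice_inner[OF ab'(3,3)]
    by (metis Ints_cases Ints_mult)
  have c0: "c \<noteq> 0"
    using assms(4) c by (auto simp: \<theta> vec_angle_def)
  \<comment> \<open>The squared cosine is \<open>c^2 / N\<close>, so the squared tangent is
    \<open>(N - c^2) / c^2\<close>; its numerator represents its square class.\<close>
  define T where "T = N - c\<^sup>2"
  have NT: "(a' \<bullet> a') * (b' \<bullet> b') = of_int (c\<^sup>2 + T)"
    by (simp add: N T_def)
  \<comment> \<open>This is strict Cauchy-Schwarz: equality would make the cosine 1 or -1, and the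
    angle 0 or \<open>pi\<close>.\<close>
  have "T > 0"
  proof (rule ccontr)
    assume "\<not> T > 0"
    then have "(a' \<bullet> a') * (b' \<bullet> b') \<le> (a' \<bullet> b')\<^sup>2"
      unfolding N c T_def by (simp flip: of_int_power)
    then have "(a' \<bullet> b')\<^sup>2 = (norm a' * norm b')\<^sup>2"
      using Cauchy_Schwarz_ineq[of a' b'] by (simp add: power_mult_distrib power2_norm_eq_inner)
    then have "a' \<bullet> b' = norm a' * norm b' \<or> a' \<bullet> b' = - (norm a' * norm b')"
      using power2_eq_iff by blast
    then have "(a' \<bullet> b') / (norm a' * norm b') = 1 \<or> (a' \<bullet> b') / (norm a' * norm b') = - 1"
      using ab' by (auto simp: field_simps)
    then have "\<theta> = 0 \<or> \<theta> = pi"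
      unfolding \<theta> vec_angle_def by (elim disjE) (simp_all only: arccos_1 arccos_minus_1 simp_thms)
    then show False
      using assms(3,5) by blast
  qed
  \<comment> \<open>The denominator is kept as an explicit square factor, so that the Hilbert
    symbols can discard it.\<close>
  have tan: "(tan \<theta>)\<^sup>2 = of_rat ((1 / of_int c)\<^sup>2 * of_int T)"
    using tan_sq_vec_angle[OF ab'(2,4)] assms(4) c0
    by (simp add: \<theta> NT c of_rat_mult of_rat_power of_rat_divide field_simps)
  have norm: "(norm a)\<^sup>2 = of_rat (of_int n)"
    by (simp add: power2_norm_eq_inner n)
  have "\<theta> \<in> Theta3_at a \<longleftrightarrow> (\<exists>b. b \<in> integer_lattice \<and> b \<noteq> 0 \<and> vec_angle a b = vec_angle a' b')"
    unfolding Theta3_at_def \<theta> by (simp, metis)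
  also have "\<dots> \<longleftrightarrow> (\<exists>b. b \<in> integer_lattice \<and> (a \<bullet> b) * (a' \<bullet> b') > 0 \<and>
    (a \<bullet> b)\<^sup>2 * ((a' \<bullet> a') * (b' \<bullet> b')) = (a' \<bullet> b')\<^sup>2 * ((a \<bullet> a) * (b \<bullet> b)))"
  proof (rule ex_cong1)
    fix b
    show "b \<in> integer_lattice \<and> b \<noteq> 0 \<and> vec_angle a b = vec_angle a' b' \<longleftrightarrow>
      b \<in> integer_lattice \<and> (a \<bullet> b) * (a' \<bullet> b') > 0 \<and>
      (a \<bullet> b)\<^sup>2 * ((a' \<bullet> a') * (b' \<bullet> b')) = (a' \<bullet> b')\<^sup>2 * ((a \<bullet> a) * (b \<bullet> b))"
      \<comment> \<open>The strict inequality already rules out \<open>b = 0\<close>, so that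
        condition disappears on the right.\<close>
      using vec_angle_eq_iff[of a b a' b'] assms(1) ab' c c0 by (cases "b = 0") auto
  qed
  also have "\<dots> \<longleftrightarrow> (\<exists>b1 b2 b3. (a1 * b1 + a2 * b2 + a3 * b3) * c > 0 \<and>
            (a1 * b1 + a2 * b2 + a3 * b3)\<^sup>2 * (c\<^sup>2 + T) = c\<^sup>2 * (n * (b1\<^sup>2 + b2\<^sup>2 + b3\<^sup>2)))"
    (is "?A \<longleftrightarrow> ?B")
  proof -
    have coords: "(a \<bullet> b) * (a' \<bullet> b') > 0 \<and>
        (a \<bullet> b)\<^sup>2 * ((a' \<bullet> a') * (b' \<bullet> b')) = (a' \<bullet> b')\<^sup>2 * ((a \<bullet> a) * (b \<bullet> b)) \<longleftrightarrow>
      (a1 * b1 + a2 * b2 + a3 * b3) * c > 0 \<and>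
        (a1 * b1 + a2 * b2 + a3 * b3)\<^sup>2 * (c\<^sup>2 + T) = c\<^sup>2 * (n * (b1\<^sup>2 + b2\<^sup>2 + b3\<^sup>2))"
      if b: "b = vector [of_int b1, of_int b2, of_int b3]" for b b1 b2 b3
    proof -
      have "a \<bullet> b = of_int (a1 * b1 + a2 * b2 + a3 * b3)"
        unfolding a b inner_vector_of_int ..
      moreover have "b \<bullet> b = of_int (b1\<^sup>2 + b2\<^sup>2 + b3\<^sup>2)"
        unfolding b inner_vector_of_int by (simp add: power2_eq_square)
      ultimately show ?thesis
        unfolding NT c n
        by (simp only: of_int_mult[symmetric] of_int_power[symmetric] of_int_0_less_iff of_int_eq_iff)
    qed
    show ?thesis
    proof
      assume ?A
      then show ?B using coords by (metis integer_latticeE)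
    next
      assume ?B
      then show ?A using coords vector_of_int_in_integer_lattice by blast
    qed
  qed
  also have "\<dots> \<longleftrightarrow> (\<forall>p. prime p \<and> odd p \<longrightarrow>
      tame_symbol p n n * tame_symbol p n T * tame_symbol p T T = 1)"
    by (rule same_angle_iff_tame_symbol[OF n_def n0 c0 \<open>T > 0\<close>])
  also have "\<dots> \<longleftrightarrow> (\<forall>p::nat. prime p \<and> odd p \<longrightarrow>
      hilbert_symbol p (rat_of_real ((norm a)\<^sup>2)) (rat_of_real ((norm a)\<^sup>2)) *
      hilbert_symbol p (rat_of_real ((norm a)\<^sup>2)) (rat_of_real ((tan \<theta>)\<^sup>2)) *
      hilbert_symbol p (rat_of_real ((tan \<theta>)\<^sup>2)) (rat_of_real ((tan \<theta>)\<^sup>2)) = 1)"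
    unfolding tan norm rat_of_real_of_rat
    using c0 n0 \<open>T > 0\<close>
    by (auto simp: hilbert_symbol_mult_square_left hilbert_symbol_mult_square_right
        hilbert_symbol_eq_tame_symbol simp del: power_one_over)
  finally show ?thesis .
qed

end
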